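(* Let $T:\mathcal J(T)\to\mathcal J(T)$ be a random critically finite map. If $0\le s\le t$, then $$0\le \mathcal E\mathrm P_\infty(s)-\mathcal E\mathrm P_\infty(t)\le \log\|T'\|_\infty\,(t-s).$$ In particular, the function $[0,+\infty)\ni u\mapsto\mathcal E\mathrm P_\infty(u)\in\mathbb R$ is monotone decreasing (i.e. non-increasing) and Lipschitz continuous with a Lipschitz constant equal to $\log\|T'\|_\infty$.
   Context: Random critically finite maps. Let $I=[0,1]$ and let $\mathcal G$ be a finite collection of closed subintervals of $I$ with pairwise disjoint interiors such that $0$ and $1$ belong to two different elements of $\mathcal G$, denoted $\Delta_0\ni 0$ and $\Delta_1\ni 1$. Put $I_*=\bigcup_{\Delta\in\mathcal G}\Delta$. Let $\mathcal G=\mathcal G_C\cup\mathcal G_E$ be a disjoint union, let $\kappa>1$, $A>1$, and let $\gamma:\mathcal G_C\to\{1,2,\dots\}$, $\Delta\mapsto\gamma_\Delta$. $\mathcal M(\mathcal G;\kappa,A,\gamma)$ is the set of continuous maps $f:I_*\to I$ such that (derivatives at endpoints of the intervals of $\mathcal G$ being one-sided, within the interval considered): (M1) for every $\Delta\in\mathcal G$, $f|_\Delta$ is $C^3$, injective, $f(\Delta)=I$, and the Schwarzian derivative $S(f|_\Delta)=\frac{f'''}{f'}-\frac32\left(\frac{f''}{f'}\right)^2$ is negative; (M2) $|f'(x)|\ge\kappa$ for all $x\in\Delta$, $\Delta\in\mathcal G_E$; (M3) for every $\Delta\in\mathcal G_C$ there is a unique $c_\Delta\in\Delta$, in fact $c_\Delta\in\partial\Delta$,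 with $f'(c_\Delta)=0$; (M4) $f(c_\Delta)\in\{0,1\}$ for all $\Delta\in\mathcal G_C$, and $f(1)=0$; (M5) $f(0)=0$, $f'(0)\ge\kappa$, $f'(1)\le-\kappa$, $\|f'\|_\infty\le A$, and there is $s\in(0,1)$ such that $(f|_{\Delta_0})^{-1}(\max\{|\Delta_0|,|\Delta_1|\})\le s$ and $|f'(x)|\ge\kappa$ for all $x\in[0,s]\cup[1-s,1]$; (M6) for every $\Delta\in\mathcal G_C$ there is a $C^3$ function $A_\Delta:\Delta\to[1/A,A]\cup[-A,-1/A]$ with $|A_\Delta'(x)|\in[1/A,A]$ and $f(x)=f(c_\Delta)+A_\Delta(x)(x-c_\Delta)^{1+\gamma_\Delta}$ for all $x\in\Delta$. The points $c_\Delta$ and values $f(c_\Delta)$ do not depend on $f$ in the class. It is assumed that (M7) there is $\Delta\in\mathcal G_C$ with $f(c_\Delta)=0$. Let $(\Omega,\mathcal F,m)$ be a complete probability space, $\theta:\Omega\to\Omega$ an invertible (bimeasurable) $m$-preserving ergodic map, and $\Omega\ni\omega\mapsto T_\omega\in\mathcal M(\mathcal G;\kappa,A,\gamma)$ measurable, i.e. $\omega\mapsto T_\omega(x)$ is measurable for every $x\in I_*$. Put $T_{\omega,\Delta}^{-1}=(T_\omega|_\Delta)^{-1}:I\to\Delta$ and $T_\omega^n=T_{\theta^{n-1}(\omega)}\circ\cdots\circ T_\omega$ where defined. Let $\mathcal J_\omega(T)=\{x\in I:T^n_\omega(x)\in I_*\ \forall n\ge0\}$, so $T_\omega(\mathcal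 J_\omega(T))=\mathcal J_{\theta(\omega)}(T)$, $\mathcal J(T)=\bigcup_{\omega}\{\omega\}\times\mathcal J_\omega(T)$, and $T:\mathcal J(T)\to\mathcal J(T)$, $T(\omega,x)=(\theta(\omega),T_\omega(x))$. This $T$ is called a random critically finite map. $\|T'\|_\infty=\operatorname{ess\,sup}_{\omega}\|T'_\omega\|_\infty$. Truncated systems and pressure. For $k\ge1$ let $T_{\omega,0}^{-k}=T_{\omega,\Delta_0}^{-1}\circ T_{\theta(\omega),\Delta_0}^{-1}\circ\cdots\circ T_{\theta^{k-1}(\omega),\Delta_0}^{-1}$, $U_\omega(k)=[T_{\omega,0}^{-k}(1),1]$, and $\mathcal J^{(k)}_\omega(T)=\bigcap_{n\ge0}T_\omega^{-n}(I_*\cap U_{\theta^n(\omega)}(k))$, a nonempty closed set with $T_\omega(\mathcal J^{(k)}_\omega(T))\subset\mathcal J^{(k)}_{\theta(\omega)}(T)$. For $t\ge0$ let $\mathcal L_{t,k,\omega}g(x)=\sum_{y\in\mathcal J^{(k)}_\omega(T),\,T_\omega(y)=x}g(y)|T_\omega'(y)|^{-t}$, an operator $C(\mathcal J^{(k)}_\omega(T))\to C(\mathcal J^{(k)}_{\theta(\omega)}(T))$. There exist a random probability measure $\nu_{t,k}$ (a probability measure on $\Omega\times I$ with marginal $m$ on $\Omega$ and disintegration $(\nu_{t,k,\omega})_\omega$) supported on $\bigcup_\omega\{\omega\}\times\mathcal J_\omega^{(k)}(T)$ and a measurable $\lambda_{t,k}:\Omega\to(0,\infty)$ with $\mathcal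 L_{t,k,\omega}^*\nu_{t,k,\theta(\omega)}=\lambda_{t,k,\omega}\nu_{t,k,\omega}$ for $m$-a.e. $\omega$. Put $\mathcal E\mathrm P_k(t)=\int_\Omega\log\lambda_{t,k,\omega}\,dm(\omega)$ (independent of the choice of $\nu_{t,k}$) and $\mathcal E\mathrm P_\infty(t)=\lim_{k\to\infty}\mathcal E\mathrm P_k(t)$ (the limit exists, the sequence being nondecreasing). *)

theory Defs
  imports "HOL-Probability.Probability"
begin

text \<open>
  Derivatives relative to a set. For a nondegenerate closed interval \<open>D\<close> these are the
  usual derivatives, one-sided at the endpoints of \<open>D\<close>.
\<close>

abbreviation deriv_in :: "real set \<Rightarrow> (real \<Rightarrow> real) \<Rightarrow> real \<Rightarrow> real" where
  "deriv_in D f x \<equiv> vector_derivative f (at x within D)"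

definition nderiv_in :: "nat \<Rightarrow> real set \<Rightarrow> (real \<Rightarrow> real) \<Rightarrow> real \<Rightarrow> real" where
  "nderiv_in n D f = (deriv_in D ^^ n) f"

definition Ck_on :: "nat \<Rightarrow> real set \<Rightarrow> (real \<Rightarrow> real) \<Rightarrow> bool" where
  "Ck_on n D f \<longleftrightarrow>
     (\<forall>j<n. nderiv_in j D f differentiable_on D) \<and> continuous_on D (nderiv_in n D f)"

definition schwarzian :: "real set \<Rightarrow> (real \<Rightarrow> real) \<Rightarrow> real \<Rightarrow> real" where
  "schwarzian D f x =
     nderiv_in 3 D f x / nderiv_in 1 D f x - 3 / 2 * (nderiv_in 2 D f x / nderiv_in 1 D f x)\<^sup>2"

text \<open>
  The family of intervals is \<open>GC \<union> GE\<close>, with \<open>D0\<close> and \<open>D1\<close> its elements containing 0 and 1.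
  The turning points \<open>c D\<close> and the critical values \<open>v D\<close> (for \<open>D \<in> GC\<close>) are data of the
  class, as they do not depend on the map.
\<close>

locale critically_finite_data =
  fixes GC GE :: "real set set"
    and D0 D1 :: "real set"
    and \<kappa> A :: real
    and \<gamma> :: "real set \<Rightarrow> nat"
    and c v :: "real set \<Rightarrow> real"
  assumes finite_GC: "finite GC" and finite_GE: "finite GE"
    and GC_GE_disjoint: "GC \<inter> GE = {}"
    and intervals: "\<And>D. D \<in> GC \<union> GE \<Longrightarrow> \<exists>a b. 0 \<le> a \<and> a < b \<and> b \<le> 1 \<and> D = {a..b}"
    and disjoint_interiors: "pairwise (\<lambda>D E. interior D \<inter> interior E = {}) (GC \<union> GE)"
    and D0: "D0 \<in> GC \<union> GE" "0 \<in> D0"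
    and D1: "D1 \<in> GC \<union> GE" "1 \<in> D1"
    and D0_neq_D1: "D0 \<noteq> D1"
    and kappa_gt_1: "\<kappa> > 1" and A_gt_1: "A > 1"
    and gamma_ge_1: "\<And>D. D \<in> GC \<Longrightarrow> \<gamma> D \<ge> 1"

text \<open>
  The Schwarzian derivative is only defined, and required to be negative, off the zeros of the
  derivative. Near 0 and 1 the bound \<open>\<kappa>\<close> is imposed at the points of \<open>\<Union>(GC \<union> GE)\<close>, where
  the map is defined.
\<close>

definition critically_finite_class ::
  "real set set \<Rightarrow> real set set \<Rightarrow> real set \<Rightarrow> real set \<Rightarrow> real \<Rightarrow> real \<Rightarrow> (real set \<Rightarrow> nat)
     \<Rightarrow> (real set \<Rightarrow> real) \<Rightarrow> (real set \<Rightarrow> real) \<Rightarrow> (real \<Rightarrow> real) set" where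
  "critically_finite_class GC GE D0 D1 \<kappa> A \<gamma> c v = {f.
     continuous_on (\<Union>(GC \<union> GE)) f \<and> f ` \<Union>(GC \<union> GE) \<subseteq> {0..1} \<and>
     (\<forall>D\<in>GC \<union> GE. Ck_on 3 D f \<and> inj_on f D \<and> f ` D = {0..1} \<and>
        (\<forall>x\<in>D. deriv_in D f x \<noteq> 0 \<longrightarrow> schwarzian D f x < 0)) \<and>
     (\<forall>D\<in>GE. \<forall>x\<in>D. \<bar>deriv_in D f x\<bar> \<ge> \<kappa>) \<and>
     (\<forall>D\<in>GC. c D \<in> D \<and> c D \<in> frontier D \<and> (\<forall>x\<in>D. deriv_in D f x = 0 \<longleftrightarrow> x = c D)) \<and>
     (\<forall>D\<in>GC. f (c D) = v D \<and> v D \<in> {0, 1}) \<and> f 1 = 0 \<and>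
     f 0 = 0 \<and> deriv_in D0 f 0 \<ge> \<kappa> \<and> deriv_in D1 f 1 \<le> - \<kappa> \<and>
     (\<forall>D\<in>GC \<union> GE. \<forall>x\<in>D. \<bar>deriv_in D f x\<bar> \<le> A) \<and>
     (\<exists>s. 0 < s \<and> s < 1 \<and>
        the_inv_into D0 f (max (measure lborel D0) (measure lborel D1)) \<le> s \<and>
        (\<forall>D\<in>GC \<union> GE. \<forall>x\<in>D \<inter> ({0..s} \<union> {1 - s..1}). \<bar>deriv_in D f x\<bar> \<ge> \<kappa>)) \<and>
     (\<forall>D\<in>GC. \<exists>a. Ck_on 3 D a \<and>
        (\<forall>x\<in>D. a x \<in> {1 / A..A} \<union> {- A..- (1 / A)} \<and> \<bar>deriv_in D a x\<bar> \<in> {1 / A..A} \<and>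
           f x = f (c D) + a x * (x - c D) ^ (1 + \<gamma> D)))}"

locale random_critically_finite_map =
  prob_space M + complete_measure M + critically_finite_data GC GE D0 D1 \<kappa> A \<gamma> c v
  for M :: "'w measure"
    and GC GE :: "real set set" and D0 D1 :: "real set"
    and \<kappa> A :: real and \<gamma> :: "real set \<Rightarrow> nat" and c v :: "real set \<Rightarrow> real" +
  fixes \<theta> :: "'w \<Rightarrow> 'w" and T :: "'w \<Rightarrow> real \<Rightarrow> real"
  assumes theta_measurable: "\<theta> \<in> measurable M M"
    and theta_bij: "bij_betw \<theta> (space M) (space M)"
    and theta_inv_measurable: "\<And>B. B \<in> sets M \<Longrightarrow> \<theta> ` B \<in> sets M"
    and theta_preserving: "distr M M \<theta> = M"
    and theta_ergodic:
      "\<And>B. B \<in> sets M \<Longrightarrow> \<theta> -` B \<inter> space M = B \<Longrightarrow> measure M B = 0 \<or> measure M B = 1"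
    and T_in_class: "\<And>\<omega>. \<omega> \<in> space M \<Longrightarrow> T \<omega> \<in> critically_finite_class GC GE D0 D1 \<kappa> A \<gamma> c v"
    and T_measurable: "\<And>x. x \<in> \<Union>(GC \<union> GE) \<Longrightarrow> (\<lambda>\<omega>. T \<omega> x) \<in> borel_measurable M"
    and critical_value_0: "\<exists>D\<in>GC. v D = 0"

text \<open>
  The essential supremum over the base of the sup norms of the fibre derivatives; at a common
  endpoint of two intervals both one-sided derivatives count.
\<close>

definition deriv_sup_norm :: "'w measure \<Rightarrow> real set set \<Rightarrow> ('w \<Rightarrow> real \<Rightarrow> real) \<Rightarrow> real" where
  "deriv_sup_norm M G T =
     real_of_ereal (esssup M (\<lambda>\<omega>. SUP D\<in>G. SUP x\<in>D. ereal \<bar>deriv_in D (T \<omega>) x\<bar>))"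

text \<open>
  Fibre maps are total functions in HOL, so \<open>fibre_iter\<close> is meaningful only as long as the
  orbit stays in the domain.
\<close>

primrec fibre_iter :: "('w \<Rightarrow> 'w) \<Rightarrow> ('w \<Rightarrow> real \<Rightarrow> real) \<Rightarrow> nat \<Rightarrow> 'w \<Rightarrow> real \<Rightarrow> real" where
  "fibre_iter \<theta> T 0 \<omega> x = x"
| "fibre_iter \<theta> T (Suc n) \<omega> x = T ((\<theta> ^^ n) \<omega>) (fibre_iter \<theta> T n \<omega> x)"

primrec inv_branch0 ::
  "('w \<Rightarrow> 'w) \<Rightarrow> ('w \<Rightarrow> real \<Rightarrow> real) \<Rightarrow> real set \<Rightarrow> nat \<Rightarrow> 'w \<Rightarrow> real \<Rightarrow> real" where
  "inv_branch0 \<theta> T D0 0 \<omega> y = y"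
| "inv_branch0 \<theta> T D0 (Suc k) \<omega> y = the_inv_into D0 (T \<omega>) (inv_branch0 \<theta> T D0 k (\<theta> \<omega>) y)"

definition trunc_interval ::
  "('w \<Rightarrow> 'w) \<Rightarrow> ('w \<Rightarrow> real \<Rightarrow> real) \<Rightarrow> real set \<Rightarrow> nat \<Rightarrow> 'w \<Rightarrow> real set" where
  "trunc_interval \<theta> T D0 k \<omega> = {inv_branch0 \<theta> T D0 k \<omega> 1..1}"

definition trunc_julia ::
  "('w \<Rightarrow> 'w) \<Rightarrow> ('w \<Rightarrow> real \<Rightarrow> real) \<Rightarrow> real set set \<Rightarrow> real set \<Rightarrow> nat \<Rightarrow> 'w \<Rightarrow> real set" where
  "trunc_julia \<theta> T G D0 k \<omega> =
     {x. \<forall>n. fibre_iter \<theta> T n \<omega> x \<in> \<Union>G \<inter> trunc_interval \<theta> T D0 k ((\<theta> ^^ n) \<omega>)}"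

text \<open>
  For \<open>k \<ge> 1\<close> the truncated sets contain no endpoint of an interval of \<open>G\<close>: endpoints are
  mapped into \<open>{0, 1}\<close>, 1 is mapped to 0, and 0 lies outside the truncating intervals. So the
  derivative relative to \<open>\<Union>G\<close> used below is an ordinary two-sided, nonzero derivative there.
\<close>

definition transfer_op ::
  "('w \<Rightarrow> 'w) \<Rightarrow> ('w \<Rightarrow> real \<Rightarrow> real) \<Rightarrow> real set set \<Rightarrow> real set \<Rightarrow> real \<Rightarrow> nat \<Rightarrow> 'w
     \<Rightarrow> (real \<Rightarrow> real) \<Rightarrow> real \<Rightarrow> real" where
  "transfer_op \<theta> T G D0 t k \<omega> g x =
     (\<Sum>y | y \<in> trunc_julia \<theta> T G D0 k \<omega> \<and> T \<omega> y = x.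
        g y * \<bar>deriv_in (\<Union>G) (T \<omega>) y\<bar> powr (- t))"

text \<open>
  Random probability measures are given by their disintegrations, that is, by Markov kernels
  \<open>\<nu>\<close> from the base to the line. The last condition is the dual eigenvalue equation tested
  against all continuous functions on the truncated fibre.
\<close>

definition random_eigenmeasure ::
  "'w measure \<Rightarrow> ('w \<Rightarrow> 'w) \<Rightarrow> ('w \<Rightarrow> real \<Rightarrow> real) \<Rightarrow> real set set \<Rightarrow> real set \<Rightarrow> real \<Rightarrow> nat
     \<Rightarrow> ('w \<Rightarrow> real measure) \<Rightarrow> ('w \<Rightarrow> real) \<Rightarrow> bool" where
  "random_eigenmeasure M \<theta> T G D0 t k \<nu> \<Lambda> \<longleftrightarrow>
     \<nu> \<in> measurable M (prob_algebra borel) \<and>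
     (AE \<omega> in M. measure (\<nu> \<omega>) (trunc_julia \<theta> T G D0 k \<omega>) = 1) \<and>
     \<Lambda> \<in> borel_measurable M \<and> (\<forall>\<omega>\<in>space M. \<Lambda> \<omega> > 0) \<and>
     (AE \<omega> in M. \<forall>g. continuous_on (trunc_julia \<theta> T G D0 k \<omega>) g \<longrightarrow>
        (LINT x:trunc_julia \<theta> T G D0 k (\<theta> \<omega>)|\<nu> (\<theta> \<omega>). transfer_op \<theta> T G D0 t k \<omega> g x)
          = \<Lambda> \<omega> * (LINT x:trunc_julia \<theta> T G D0 k \<omega>|\<nu> \<omega>. g x))"

definition expected_pressure ::
  "'w measure \<Rightarrow> (real \<Rightarrow> nat \<Rightarrow> 'w \<Rightarrow> real) \<Rightarrow> nat \<Rightarrow> real \<Rightarrow> real" where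
  "expected_pressure M \<Lambda> k t = (\<integral>\<omega>. ln (\<Lambda> t k \<omega>) \<partial>M)"

definition expected_pressure_inf ::
  "'w measure \<Rightarrow> (real \<Rightarrow> nat \<Rightarrow> 'w \<Rightarrow> real) \<Rightarrow> real \<Rightarrow> real" where
  "expected_pressure_inf M \<Lambda> t = lim (\<lambda>k. expected_pressure M \<Lambda> k t)"

end

theory Submission
  imports Defs
begin

text \<open>
  Negative Schwarzian derivative makes \<open>\<bar>f'\<bar>\<close> to the power \<open>-1/2\<close> convex, which gives two cross-ratio
  inequalities for the inverse branches of the fibre maps. Both are preserved under composition and
  together imply Koebe distortion bounds for all inverse branches of all iterates on compact
  subintervals of \<open>(0, 1)\<close>; moreover each such branch is a weak contraction at the midpoint \<open>1/2\<close>.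
  The truncated Julia sets stay at a distance from \<open>{0, 1}\<close> that depends on \<open>k\<close> only, so the products of
  \<open>\<lambda>\<close> along an orbit of length \<open>n\<close> are comparable, up to a constant independent of \<open>n\<close>, to the sum over
  admissible words \<open>w\<close> of length \<open>n\<close> of the derivatives of the branches at \<open>1/2\<close>, to the power \<open>t\<close>. These
  sums are visibly nonincreasing in \<open>t\<close>, nondecreasing in \<open>k\<close>, at most \<open>card \<G>\<close> to the power \<open>n\<close>, and
  change by at most a factor \<open>\<parallel>T'\<parallel>\<close> to the power \<open>n (t - s)\<close> between \<open>s\<close> and \<open>t\<close>. Integrating logarithms,
  dividing by \<open>n\<close> and letting \<open>n\<close> and then \<open>k\<close> tend to infinity yields the claim.
\<close>

section \<open>Negative Schwarzian derivative\<close>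

text \<open>The transfer operators cannot be compared term by term: near a turning point the modulus
  of the derivative is below 1, so its power \<open>- t\<close> grows with \<open>t\<close>. The
  eigenmeasures for different \<open>t\<close> and \<open>k\<close> also carry no a priori relation.
  Sums over words refer to no measure, and at the midpoint the missing expansion is replaced by the
  fact that a branch maps the unit interval into itself.

  Truncation creates a second obstacle. At a given point not every admissible word can be followed,
  since a run of \<open>D0\<close> may be cut off there. One extra symbol \<open>D1\<close> ends the
  run, and this is why the lower estimate compares words of length \<open>n\<close> with products of
  \<open>n + 1\<close> eigenvalues.

  The distortion constant deteriorates as \<open>k\<close> grows, so it cannot bound the pressures
  uniformly in \<open>k\<close>. At \<open>t = 0\<close> the constant enters with power 0 and
  disappears; boundedness for all other \<open>t\<close> then follows from monotonicity in
  \<open>t\<close>.\<close>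

lemma affine_comparison:
  fixes f u :: "real \<Rightarrow> real" and p q :: real
  defines "l \<equiv> \<lambda>z. p + q * z"
  assumes "x < y" and cont: "continuous_on {x..y} f"
    and der: "\<And>z. x < z \<Longrightarrow> z < y \<Longrightarrow> (f has_real_derivative u z) (at z)"
    and pos: "0 < l x" "0 < l y"
  shows "(\<And>z. x < z \<Longrightarrow> z < y \<Longrightarrow> u z \<le> 1 / (l z)\<^sup>2) \<Longrightarrow> f y - f x \<le> (y - x) / (l x * l y)"
    and "(\<And>z. x < z \<Longrightarrow> z < y \<Longrightarrow> 1 / (l z)\<^sup>2 \<le> u z) \<Longrightarrow> (y - x) / (l x * l y) \<le> f y - f x"
proof -
  \<comment> \<open>The second term is the primitive of \<open>1 / (l z)\<^sup>2\<close> that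
    vanishes at \<open>x\<close>. It is a Moebius map, the case of zero Schwarzian derivative, and
    serves as the model for \<open>f\<close>.\<close>
  define H where "H = (\<lambda>z. f z - (z - x) / (l x * l z))"
  have lpos: "0 < l z" if "x \<le> z" "z \<le> y" for z
  proof (cases "q \<ge> 0")
    case True
    then have "q * x \<le> q * z" using that by (simp add: mult_left_mono)
    then show ?thesis using pos by (simp add: l_def)
  next
    case False
    then have "q * y \<le> q * z" using that by (simp add: mult_left_mono_neg)
    then show ?thesis using pos by (simp add: l_def)
  qed
  have contH: "continuous_on {x..y} H"
    unfolding H_def
    using lpos pos by (intro continuous_intros cont; force simp: l_def intro!: continuous_intros)
  have derH: "(H has_real_derivative u z - 1 / (l z)\<^sup>2) (at z)" if "x < z" "z < y" for z
  proof -
    have l: "l z \<noteq> 0" "l x \<noteq> 0" using lpos[of z] pos that by auto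
    have "((\<lambda>z. (z - x) / (l x * l z)) has_real_derivative
            (1 * (l x * l z) - (z - x) * (l x * q)) / (l x * l z * (l x * l z))) (at z)"
      using l unfolding l_def by (auto intro!: derivative_eq_intros)
    moreover have "(1 * (l x * l z) - (z - x) * (l x * q)) = l x * l x"
      by (simp add: l_def algebra_simps)
    moreover have "l x * l x / (l x * l z * (l x * l z)) = 1 / (l z)\<^sup>2"
      using l by (simp add: power2_eq_square)
    ultimately have "((\<lambda>z. (z - x) / (l x * l z)) has_real_derivative 1 / (l z)\<^sup>2) (at z)"
      by simp
    then show ?thesis
      unfolding H_def using der[OF that] by (intro DERIV_diff)
  qed
  have H: "H x = f x" "H y = f y - (y - x) / (l x * l y)" by (auto simp: H_def)
  show "f y - f x \<le> (y - x) / (l x * l y)"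
    if "\<And>z. x < z \<Longrightarrow> z < y \<Longrightarrow> u z \<le> 1 / (l z)\<^sup>2"
  proof -
    have "H y \<le> H x"
    proof (rule DERIV_nonpos_imp_decreasing_open[where f = H])
      fix z assume z: "x < z" "z < y"
      show "\<exists>D. (H has_real_derivative D) (at z) \<and> D \<le> 0"
        using derH[OF z] that[OF z] by (intro exI[of _ "u z - 1 / (l z)\<^sup>2"]) simp
    qed (use \<open>x < y\<close> contH in auto)
    then show ?thesis using H by simp
  qed
  show "(y - x) / (l x * l y) \<le> f y - f x"
    if "\<And>z. x < z \<Longrightarrow> z < y \<Longrightarrow> 1 / (l z)\<^sup>2 \<le> u z"
  proof -
    have "H x \<le> H y"
    proof (rule DERIV_nonneg_imp_increasing_open[where f = H])
      fix z assume z: "x < z" "z < y"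
      show "\<exists>D. (H has_real_derivative D) (at z) \<and> D \<ge> 0"
        using derH[OF z] that[OF z] by (intro exI[of _ "u z - 1 / (l z)\<^sup>2"]) simp
    qed (use \<open>x < y\<close> contH in auto)
    then show ?thesis using H by simp
  qed
qed

context
  fixes f u u1 u2 :: "real \<Rightarrow> real" and a b :: real
  assumes cont: "continuous_on {a..b} f"
    and der: "\<And>z. a < z \<Longrightarrow> z < b \<Longrightarrow> (f has_real_derivative u z) (at z)"
    and der1: "\<And>z. a < z \<Longrightarrow> z < b \<Longrightarrow> (u has_real_derivative u1 z) (at z)"
    and der2: "\<And>z. a < z \<Longrightarrow> z < b \<Longrightarrow> (u1 has_real_derivative u2 z) (at z)"
    and upos: "\<And>z. a < z \<Longrightarrow> z < b \<Longrightarrow> 0 < u z"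
    and schw: "\<And>z. a < z \<Longrightarrow> z < b \<Longrightarrow> u2 z / u z - 3 / 2 * (u1 z / u z)\<^sup>2 < 0"
begin

definition inv_sqrt :: "real \<Rightarrow> real" where "inv_sqrt z = u z powr (- 1 / 2)"

lemma inv_sqrt_pos: "a < z \<Longrightarrow> z < b \<Longrightarrow> 0 < inv_sqrt z"
  using upos[of z] by (simp add: inv_sqrt_def)

lemma inv_sqrt_sq: assumes "a < z" "z < b" shows "u z = 1 / (inv_sqrt z)\<^sup>2"
proof -
  have "(inv_sqrt z)\<^sup>2 = u z powr (- 1)"
    by (simp add: inv_sqrt_def power2_eq_square flip: powr_add)
  then show ?thesis using upos[OF assms] by (simp add: powr_minus_divide)
qed

lemma inv_sqrt_deriv:
  assumes "a < z" "z < b"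
  shows "(inv_sqrt has_real_derivative (- 1 / 2) * u z powr (- 3 / 2) * u1 z) (at z)"
  unfolding inv_sqrt_def using upos[OF assms] der1[OF assms]
  by (auto intro!: derivative_eq_intros)

text \<open>The second derivative of \<open>inv_sqrt\<close> is \<open>- 1 / 2\<close> times the
  Schwarzian derivative times \<open>inv_sqrt\<close>, so negativity of the former turns into
  convexity.\<close>

lemma inv_sqrt_convex: "convex_on {a<..<b} inv_sqrt"
proof (rule f''_ge0_imp_convex)
  fix z assume "z \<in> {a<..<b}"
  then have z: "a < z" "z < b" by auto
  note up = upos[OF z]
  show "(inv_sqrt has_real_derivative (- 1 / 2) * u z powr (- 3 / 2) * u1 z) (at z)"
    by (rule inv_sqrt_deriv[OF z])
  show "((\<lambda>z. (- 1 / 2) * u z powr (- 3 / 2) * u1 z) has_real_derivative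
           u z powr (- 5 / 2) * (3 / 4 * (u1 z)\<^sup>2 - 1 / 2 * u z * u2 z)) (at z)"
  proof -
    have "u z powr (- 3 / 2) = u z powr (- 5 / 2) * u z"
      using up powr_add[of "u z" "- 5 / 2" 1] by simp
    then have eq: "u z powr (- 5 / 2) * (3 / 4 * (u1 z)\<^sup>2 - 1 / 2 * u z * u2 z)
        = (- 1 / 2) * ((- 3 / 2) * u z powr (- 5 / 2) * u1 z) * u1 z
          + u2 z * ((- 1 / 2) * u z powr (- 3 / 2))"
      by (simp add: power2_eq_square algebra_simps)
    have "((\<lambda>z. u z powr (- 3 / 2)) has_real_derivative
        (- 3 / 2) * u z powr (- 5 / 2) * u1 z) (at z)"
      using up der1[OF z] by (auto intro!: derivative_eq_intros)
    then have "((\<lambda>z. (- 1 / 2) * u z powr (- 3 / 2)) has_real_derivative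
        (- 1 / 2) * ((- 3 / 2) * u z powr (- 5 / 2) * u1 z)) (at z)"
      by (rule DERIV_cmult)
    from DERIV_mult[OF this der2[OF z]] show ?thesis unfolding eq .
  qed
  have "u2 z / u z < 3 / 2 * (u1 z / u z)\<^sup>2" using schw[OF z] by simp
  then have "u2 z / u z * (u z)\<^sup>2 < 3 / 2 * (u1 z / u z)\<^sup>2 * (u z)\<^sup>2"
    using up by (intro mult_strict_right_mono) auto
  then have "u2 z * u z < 3 / 2 * (u1 z)\<^sup>2"
    using up by (simp add: power2_eq_square)
  then show "u z powr (- 5 / 2) * (3 / 4 * (u1 z)\<^sup>2 - 1 / 2 * u z * u2 z) \<ge> 0"
    by (intro mult_nonneg_nonneg) (auto simp: algebra_simps)
qed auto

text \<open>A convex function lies below its chord, so on \<open>{x..y}\<close> the map grows at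
  least as fast as the Moebius model with the same derivatives at \<open>x\<close> and
  \<open>y\<close>. For that model the inequality is an equality.\<close>

lemma secant_bound:
  assumes "a < x" "x < y" "y < b"
  shows "u x * u y * (y - x)\<^sup>2 \<le> (f y - f x)\<^sup>2"
proof -
  define q where "q = (inv_sqrt y - inv_sqrt x) / (y - x)"
  define p where "p = inv_sqrt x - q * x"
  have "q * (y - x) = inv_sqrt y - inv_sqrt x" using assms by (simp add: q_def)
  then have l: "p + q * x = inv_sqrt x" "p + q * y = inv_sqrt y"
    by (auto simp: p_def algebra_simps)
  have hp: "0 < inv_sqrt x" "0 < inv_sqrt y" using inv_sqrt_pos assms by auto
  have conv: "convex_on {x..y} inv_sqrt"
    using inv_sqrt_convex assms by (auto intro: convex_on_subset)
  have le: "(y - x) / ((p + q * x) * (p + q * y)) \<le> f y - f x"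
  proof (rule affine_comparison(2)[where u = u])
    show "continuous_on {x..y} f" using cont assms by (auto intro: continuous_on_subset)
    fix z assume z: "x < z" "z < y"
    then show "(f has_real_derivative u z) (at z)" using der assms by auto
    have "inv_sqrt z \<le> (inv_sqrt y - inv_sqrt x) / (y - x) * (z - x) + inv_sqrt x"
      using convex_onD_Icc'[OF conv, of z] z by auto
    also have "\<dots> = p + q * z" by (simp add: p_def algebra_simps flip: q_def)
    finally have "(inv_sqrt z)\<^sup>2 \<le> (p + q * z)\<^sup>2"
      using inv_sqrt_pos[of z] z assms by (intro power_mono) auto
    moreover have "0 < (inv_sqrt z)\<^sup>2" using inv_sqrt_pos[of z] z assms by auto
    ultimately show "1 / (p + q * z)\<^sup>2 \<le> u z"
      using inv_sqrt_sq[of z] z assms by (auto intro!: divide_left_mono mult_pos_pos)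
  qed (use assms hp l in auto)
  have "0 \<le> (y - x) / (inv_sqrt x * inv_sqrt y)" using assms hp by auto
  then have "((y - x) / (inv_sqrt x * inv_sqrt y))\<^sup>2 \<le> (f y - f x)\<^sup>2"
    using le l by (intro power_mono) auto
  moreover have "((y - x) / (inv_sqrt x * inv_sqrt y))\<^sup>2 = u x * u y * (y - x)\<^sup>2"
    using inv_sqrt_sq[of x] inv_sqrt_sq[of y] assms by (simp add: power_divide power_mult_distrib)
  ultimately show ?thesis by simp
qed

lemma increments_pos:
  assumes "a \<le> x" "x < y" "y \<le> b"
  shows "f x < f y"
proof (rule DERIV_pos_imp_increasing_open[where f = f])
  show "continuous_on {x..y} f" using cont assms by (auto intro: continuous_on_subset)
  fix z assume "x < z" "z < y"
  then have "a < z" "z < b" using assms by auto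
  then show "\<exists>D. (f has_real_derivative D) (at z) \<and> D > 0" using der upos by blast
qed (use assms in auto)

text \<open>The tangent of \<open>inv_sqrt\<close> at \<open>y\<close> lies below it, so on both
  sides of \<open>y\<close> the map grows at most like the Moebius model given by the tangent. The
  derivative enters at \<open>y\<close> only, so \<open>x\<close> and \<open>z\<close> may be the
  endpoints, where nothing is assumed about \<open>u\<close>.\<close>

lemma cross_ratio_bound:
  assumes "a \<le> x" "x < y" "y < z" "z \<le> b"
  shows "(f y - f x) * (f z - f y) * (z - x) \<le> u y * (f z - f x) * (y - x) * (z - y)"
proof -
  have y: "a < y" "y < b" using assms by auto
  define q where "q = (- 1 / 2) * u y powr (- 3 / 2) * u1 y"
  define p where "p = inv_sqrt y - q * y"
  have ly: "p + q * y = inv_sqrt y" by (simp add: p_def)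
  note hy = inv_sqrt_pos[OF y]
  have fp: "0 < f y - f x" "0 < f z - f y" using increments_pos assms by auto
  have tan: "p + q * w \<le> inv_sqrt w" if "a < w" "w < b" for w
  proof -
    have "inv_sqrt w - inv_sqrt y \<ge> q * (w - y)"
      using inv_sqrt_deriv[OF y] y that
      by (intro convex_on_imp_above_tangent[OF inv_sqrt_convex])
         (auto simp: q_def interior_open intro: has_field_derivative_at_within)
    then show ?thesis by (simp add: p_def algebra_simps)
  qed
  have der_le: "u w \<le> 1 / (p + q * w)\<^sup>2" if "a < w" "w < b" "0 < p + q * w" for w
  proof -
    have "(p + q * w)\<^sup>2 \<le> (inv_sqrt w)\<^sup>2" using tan that by (intro power_mono) auto
    then show ?thesis using inv_sqrt_sq[of w] inv_sqrt_pos[of w] that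
      by (auto intro!: divide_left_mono mult_pos_pos)
  qed
  have pos_between: "0 < p + q * w" if "v \<le> w \<and> w \<le> y \<or> y \<le> w \<and> w \<le> v" "0 < p + q * v" for v w
  proof (cases "q \<ge> 0")
    case True
    have "min v y \<le> w" using that by auto
    then have "q * min v y \<le> q * w" using True by (intro mult_left_mono) auto
    moreover have "0 < p + q * min v y" using that ly hy by (auto simp: min_def)
    ultimately show ?thesis by linarith
  next
    case False
    have "w \<le> max v y" using that by auto
    then have "q * max v y \<le> q * w" using False by (intro mult_left_mono_neg) auto
    moreover have "0 < p + q * max v y" using that ly hy by (auto simp: max_def)
    ultimately show ?thesis by linarith
  qed
  have right: "(p + q * z) * inv_sqrt y * (f z - f y) \<le> z - y"
  \<comment> \<open>If the tangent is nonpositive at \<open>z\<close>, the model has a pole on the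
    way and gives no bound; the inequality cleared of denominators then holds by sign.\<close>
  proof (cases "0 < p + q * z")
    case True
    have "f z - f y \<le> (z - y) / ((p + q * y) * (p + q * z))"
    proof (rule affine_comparison(1)[where u = u])
      show "continuous_on {y..z} f" using cont assms by (auto intro: continuous_on_subset)
      fix w assume w: "y < w" "w < z"
      show "(f has_real_derivative u w) (at w)" using der w assms by auto
      show "u w \<le> 1 / (p + q * w)\<^sup>2" using w assms pos_between[of z w] True by (intro der_le) auto
    qed (use assms True hy ly in auto)
    then show ?thesis using True hy unfolding ly
      by (subst (asm) pos_le_divide_eq) (simp_all add: mult_ac)
  next
    case False
    then have "(p + q * z) * (inv_sqrt y * (f z - f y)) \<le> 0"
      using hy fp by (intro mult_nonpos_nonneg) auto
    then show ?thesis using assms by (simp add: mult.assoc)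
  qed
  have left: "(p + q * x) * inv_sqrt y * (f y - f x) \<le> y - x"
  proof (cases "0 < p + q * x")
    case True
    have "f y - f x \<le> (y - x) / ((p + q * x) * (p + q * y))"
    proof (rule affine_comparison(1)[where u = u])
      show "continuous_on {x..y} f" using cont assms by (auto intro: continuous_on_subset)
      fix w assume w: "x < w" "w < y"
      show "(f has_real_derivative u w) (at w)" using der w assms by auto
      show "u w \<le> 1 / (p + q * w)\<^sup>2" using w assms pos_between[of x w] True by (intro der_le) auto
    qed (use assms True hy ly in auto)
    then show ?thesis using True hy unfolding ly
      by (subst (asm) pos_le_divide_eq) (simp_all add: mult_ac)
  next
    case False
    then have "(p + q * x) * (inv_sqrt y * (f y - f x)) \<le> 0"
      using hy fp by (intro mult_nonpos_nonneg) auto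
    then show ?thesis using assms by (simp add: mult.assoc)
  qed
  \<comment> \<open>Multiplying each one-sided estimate by the increment and the length on the other
    side gives both terms a common factor, and the values of the tangent at \<open>x\<close> and
    \<open>z\<close> combine into its value at \<open>y\<close>.\<close>
  have "(p + q * z) * inv_sqrt y * (f z - f y) * ((f y - f x) * (y - x))
          + (p + q * x) * inv_sqrt y * (f y - f x) * ((f z - f y) * (z - y))
        \<le> (z - y) * ((f y - f x) * (y - x)) + (y - x) * ((f z - f y) * (z - y))"
    using fp assms by (intro add_mono mult_right_mono left right) auto
  also have "\<dots> = (f z - f x) * (y - x) * (z - y)" by (simp add: algebra_simps)
  also have "(p + q * z) * inv_sqrt y * (f z - f y) * ((f y - f x) * (y - x))
          + (p + q * x) * inv_sqrt y * (f y - f x) * ((f z - f y) * (z - y))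
        = inv_sqrt y * (f z - f y) * (f y - f x) * ((p + q * z) * (y - x) + (p + q * x) * (z - y))"
    by (simp add: algebra_simps)
  also have "(p + q * z) * (y - x) + (p + q * x) * (z - y) = (p + q * y) * (z - x)"
    by (simp add: algebra_simps)
  also note ly
  finally have "(inv_sqrt y)\<^sup>2 * ((f y - f x) * (f z - f y) * (z - x)) \<le> (f z - f x) * (y - x) * (z - y)"
    by (simp add: power2_eq_square mult_ac)
  then have "u y * ((inv_sqrt y)\<^sup>2 * ((f y - f x) * (f z - f y) * (z - x)))
      \<le> u y * ((f z - f x) * (y - x) * (z - y))"
    using upos[OF y] by (intro mult_left_mono) auto
  moreover have "u y * (inv_sqrt y)\<^sup>2 = 1" using inv_sqrt_sq[OF y] hy by simp
  ultimately show ?thesis by (simp only: mult.assoc[symmetric])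
qed

end

section \<open>Koebe distortion\<close>

text \<open>
  Here \<open>\<psi>\<close> is an inverse branch and \<open>d\<close> the modulus of its derivative, required on the open interval
  only since a branch may have a critical value at 0 or 1. The last two clauses are limit cases of
  the expansion of cross-ratios by the forward map.
\<close>

definition koebe_pair :: "(real \<Rightarrow> real) \<Rightarrow> (real \<Rightarrow> real) \<Rightarrow> bool" where
  "koebe_pair \<psi> d \<longleftrightarrow>
     \<psi> ` {0..1} \<subseteq> {0..1} \<and>
     ((\<forall>x y. 0 \<le> x \<longrightarrow> x < y \<longrightarrow> y \<le> 1 \<longrightarrow> \<psi> x < \<psi> y) \<or>
      (\<forall>x y. 0 \<le> x \<longrightarrow> x < y \<longrightarrow> y \<le> 1 \<longrightarrow> \<psi> y < \<psi> x)) \<and>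
     (\<forall>x. 0 < x \<longrightarrow> x < 1 \<longrightarrow> 0 < d x) \<and>
     (\<forall>x y z. 0 \<le> x \<longrightarrow> x < y \<longrightarrow> y < z \<longrightarrow> z \<le> 1 \<longrightarrow>
        d y * ((y - x) * (z - y) * \<bar>\<psi> z - \<psi> x\<bar>) \<le> (z - x) * \<bar>\<psi> y - \<psi> x\<bar> * \<bar>\<psi> z - \<psi> y\<bar>) \<and>
     (\<forall>x y. 0 < x \<longrightarrow> x < y \<longrightarrow> y < 1 \<longrightarrow> (\<psi> y - \<psi> x)\<^sup>2 \<le> d x * d y * (y - x)\<^sup>2)"

lemma koebe_pair_id: "koebe_pair (\<lambda>x. x) (\<lambda>x. 1)"
  by (auto simp: koebe_pair_def)

context
  fixes \<psi> d :: "real \<Rightarrow> real"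
  assumes kp: "koebe_pair \<psi> d"
begin

lemma koebe_pair_range: "0 \<le> x \<Longrightarrow> x \<le> 1 \<Longrightarrow> 0 \<le> \<psi> x \<and> \<psi> x \<le> 1"
  using kp unfolding koebe_pair_def by (auto simp: image_subset_iff)

lemma koebe_pair_mono:
  obtains "\<And>x y. 0 \<le> x \<Longrightarrow> x < y \<Longrightarrow> y \<le> 1 \<Longrightarrow> \<psi> x < \<psi> y"
  | "\<And>x y. 0 \<le> x \<Longrightarrow> x < y \<Longrightarrow> y \<le> 1 \<Longrightarrow> \<psi> y < \<psi> x"
  using kp unfolding koebe_pair_def by blast

lemma koebe_pair_neq: "0 \<le> x \<Longrightarrow> x < y \<Longrightarrow> y \<le> 1 \<Longrightarrow> \<psi> x \<noteq> \<psi> y"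
  by (rule koebe_pair_mono) fastforce+

lemma koebe_pair_interior:
  assumes "0 < x" "x < 1" shows "0 < \<psi> x" "\<psi> x < 1"
proof -
  have "(0 \<le> \<psi> 0 \<and> \<psi> 0 \<le> 1) \<and> (0 \<le> \<psi> 1 \<and> \<psi> 1 \<le> 1)" using koebe_pair_range by auto
  moreover have "\<psi> 0 < \<psi> x \<and> \<psi> x < \<psi> 1 \<or> \<psi> 1 < \<psi> x \<and> \<psi> x < \<psi> 0"
    using koebe_pair_mono assms by (metis less_eq_real_def)
  ultimately show "0 < \<psi> x" "\<psi> x < 1" by auto
qed

lemma koebe_pair_pos: "0 < x \<Longrightarrow> x < 1 \<Longrightarrow> 0 < d x"
  using kp unfolding koebe_pair_def by blast

lemma koebe_pair_cross_ratio:
  "0 \<le> x \<Longrightarrow> x < y \<Longrightarrow> y < z \<Longrightarrow> z \<le> 1 \<Longrightarrow>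
   d y * ((y - x) * (z - y) * \<bar>\<psi> z - \<psi> x\<bar>) \<le> (z - x) * \<bar>\<psi> y - \<psi> x\<bar> * \<bar>\<psi> z - \<psi> y\<bar>"
  using kp unfolding koebe_pair_def by blast

lemma koebe_pair_secant:
  "0 < x \<Longrightarrow> x < y \<Longrightarrow> y < 1 \<Longrightarrow> (\<psi> y - \<psi> x)\<^sup>2 \<le> d x * d y * (y - x)\<^sup>2"
  using kp unfolding koebe_pair_def by blast

text \<open>The cross-ratio clause for the triple \<open>0\<close>, \<open>x\<close>,
  \<open>y\<close> bounds the secant slope between \<open>x\<close> and \<open>y\<close> below in
  terms of \<open>d x\<close>, and the secant clause bounds it above by the geometric mean of
  \<open>d x\<close> and \<open>d y\<close>. Eliminating the slope leaves a loss given by the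
  distance of \<open>x\<close> from 0.\<close>

lemma koebe_distortion_left:
  assumes "0 < x" "x < y" "y < 1"
  shows "x\<^sup>2 * d x \<le> d y"
proof -
  have dpos: "0 < d x" "0 < d y" using koebe_pair_pos assms by auto
  define p q where "p = \<bar>\<psi> x - \<psi> 0\<bar>" and "q = \<bar>\<psi> y - \<psi> x\<bar>"
  have pq: "0 < p" "0 < q" using koebe_pair_neq[of 0 x] koebe_pair_neq[of x y] assms
    by (auto simp: p_def q_def)
  have le: "p \<le> \<bar>\<psi> y - \<psi> 0\<bar>"
    using assms by (rule_tac koebe_pair_mono) (smt (verit) p_def)+
  have "d x * (x * (y - x) * p) \<le> d x * ((x - 0) * (y - x) * \<bar>\<psi> y - \<psi> 0\<bar>)"
    using le assms dpos by (intro mult_left_mono) auto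
  also have "\<dots> \<le> (y - 0) * \<bar>\<psi> x - \<psi> 0\<bar> * \<bar>\<psi> y - \<psi> x\<bar>"
    using assms by (intro koebe_pair_cross_ratio) auto
  also have "\<dots> \<le> 1 * p * q" unfolding p_def q_def using assms by (intro mult_right_mono) auto
  finally have "(d x * (x * (y - x))) * p \<le> q * p" by (simp add: mult_ac)
  then have "d x * (x * (y - x)) \<le> q" using pq by simp
  then have "(d x * (x * (y - x)))\<^sup>2 \<le> q\<^sup>2" using assms dpos by (intro power_mono) auto
  also have "\<dots> \<le> d x * d y * (y - x)\<^sup>2"
    using koebe_pair_secant[OF assms] by (simp add: q_def)
  finally have "(x\<^sup>2 * d x) * (d x * (y - x)\<^sup>2) \<le> d y * (d x * (y - x)\<^sup>2)"
    by (simp add: power2_eq_square mult_ac)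
  moreover have "0 < d x * (y - x)\<^sup>2" using dpos assms by simp
  ultimately show ?thesis by (rule mult_right_le_imp_le)
qed

text \<open>Mirror image of the previous argument, with 1 in place of 0 as the outer point.\<close>

lemma koebe_distortion_right:
  assumes "0 < x" "x < y" "y < 1"
  shows "(1 - y)\<^sup>2 * d y \<le> d x"
proof -
  have dpos: "0 < d x" "0 < d y" using koebe_pair_pos assms by auto
  define p q where "p = \<bar>\<psi> 1 - \<psi> y\<bar>" and "q = \<bar>\<psi> y - \<psi> x\<bar>"
  have pq: "0 < p" "0 < q" using koebe_pair_neq[of y 1] koebe_pair_neq[of x y] assms
    by (auto simp: p_def q_def)
  have le: "p \<le> \<bar>\<psi> 1 - \<psi> x\<bar>"
    using assms by (rule_tac koebe_pair_mono) (smt (verit) p_def)+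
  have "d y * ((y - x) * (1 - y) * p) \<le> d y * ((y - x) * (1 - y) * \<bar>\<psi> 1 - \<psi> x\<bar>)"
    using le assms dpos by (intro mult_left_mono) auto
  also have "\<dots> \<le> (1 - x) * \<bar>\<psi> y - \<psi> x\<bar> * \<bar>\<psi> 1 - \<psi> y\<bar>"
    using assms by (intro koebe_pair_cross_ratio) auto
  also have "\<dots> \<le> 1 * q * p" unfolding p_def q_def using assms by (intro mult_right_mono) auto
  finally have "(d y * ((y - x) * (1 - y))) * p \<le> q * p" by (simp add: mult_ac)
  then have "d y * ((y - x) * (1 - y)) \<le> q" using pq by simp
  then have "(d y * ((y - x) * (1 - y)))\<^sup>2 \<le> q\<^sup>2" using assms dpos by (intro power_mono) auto
  also have "\<dots> \<le> d x * d y * (y - x)\<^sup>2"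
    using koebe_pair_secant[OF assms] by (simp add: q_def)
  finally have "((1 - y)\<^sup>2 * d y) * (d y * (y - x)\<^sup>2) \<le> d x * (d y * (y - x)\<^sup>2)"
    by (simp add: power2_eq_square mult_ac)
  moreover have "0 < d y * (y - x)\<^sup>2" using dpos assms by simp
  ultimately show ?thesis by (rule mult_right_le_imp_le)
qed

text \<open>
  The midpoint bound is what makes the pressure monotone in \<open>t\<close>, although the fibre maps need not
  be expanding.
\<close>

lemma koebe_half_le_1: "d (1 / 2) \<le> 1"
proof -
  define p q where "p = \<bar>\<psi> (1 / 2) - \<psi> 0\<bar>" and "q = \<bar>\<psi> 1 - \<psi> (1 / 2)\<bar>"
  have pq: "0 < p" "0 < q" using koebe_pair_neq[of 0 "1/2"] koebe_pair_neq[of "1/2" 1]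
    by (auto simp: p_def q_def)
  have eq: "\<bar>\<psi> 1 - \<psi> 0\<bar> = p + q"
    unfolding p_def q_def
  proof (rule koebe_pair_mono)
    assume "\<And>x y. 0 \<le> x \<Longrightarrow> x < y \<Longrightarrow> y \<le> 1 \<Longrightarrow> \<psi> x < \<psi> y"
    from this[of 0 "1 / 2"] this[of "1 / 2" 1] show "\<bar>\<psi> 1 - \<psi> 0\<bar> = \<bar>\<psi> (1 / 2) - \<psi> 0\<bar> + \<bar>\<psi> 1 - \<psi> (1 / 2)\<bar>" by simp
  next
    assume "\<And>x y. 0 \<le> x \<Longrightarrow> x < y \<Longrightarrow> y \<le> 1 \<Longrightarrow> \<psi> y < \<psi> x"
    from this[of 0 "1 / 2"] this[of "1 / 2" 1] show "\<bar>\<psi> 1 - \<psi> 0\<bar> = \<bar>\<psi> (1 / 2) - \<psi> 0\<bar> + \<bar>\<psi> 1 - \<psi> (1 / 2)\<bar>" by simp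
  qed
  have le: "p + q \<le> 1" using koebe_pair_range[of 0] koebe_pair_range[of 1] eq by auto
  \<comment> \<open>The two half lengths produce the factor 4 below; \<open>p + q\<close> is the
    length of the image of the unit interval.\<close>
  have "d (1 / 2) * ((1 / 2 - 0) * (1 - 1 / 2) * \<bar>\<psi> 1 - \<psi> 0\<bar>) \<le> (1 - 0) * p * q"
    unfolding p_def q_def by (rule koebe_pair_cross_ratio) auto
  then have "d (1 / 2) * (p + q) \<le> 4 * p * q" by (simp add: eq)
  also have "\<dots> \<le> (p + q) * (p + q)"
    using sum_squares_bound[of p q] by (simp add: power2_eq_square algebra_simps)
  also have "\<dots> \<le> 1 * (p + q)" using le pq by (intro mult_right_mono) auto
  finally show ?thesis using pq by simp
qed

text \<open>The loss in the distortion bounds depends only on the point whose derivative stands on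
  the smaller side, here the midpoint. So the factor 4 is good up to the endpoints; in the reverse
  estimate \<open>koebe_le_half\<close> it is \<open>x\<close> that must keep away from 0 and
  1.\<close>

lemma koebe_half_le:
  assumes "0 < x" "x < 1" shows "d (1 / 2) \<le> 4 * d x"
proof -
  consider "x < 1 / 2" | "x = 1 / 2" | "1 / 2 < x" by linarith
  then show ?thesis
  proof cases
    case 1
    with koebe_distortion_right[of x "1 / 2"] assms show ?thesis by (simp add: power2_eq_square)
  next
    case 2
    then have "d x = d (1 / 2)" by (simp only:)
    with koebe_pair_pos[OF assms] show ?thesis by linarith
  next
    case 3
    with koebe_distortion_left[of "1 / 2" x] assms show ?thesis by (simp add: power2_eq_square)
  qed
qed

lemma koebe_le_half:
  assumes "0 < \<delta>" "\<delta> \<le> x" "x \<le> 1 - \<delta>" shows "d x \<le> d (1 / 2) / \<delta>\<^sup>2"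
proof -
  have x: "0 < x" "x < 1" "\<delta> \<le> 1" using assms by auto
  note pos = koebe_pair_pos[OF x(1,2)]
  have "\<delta>\<^sup>2 * d x \<le> d (1 / 2)"
  proof -
    consider "x < 1 / 2" | "x = 1 / 2" | "1 / 2 < x" by linarith
    then show ?thesis
    proof cases
      case 1
      have "\<delta>\<^sup>2 * d x \<le> x\<^sup>2 * d x"
        using assms pos by (intro mult_right_mono power_mono) auto
      with koebe_distortion_left[of x "1 / 2"] x 1 show ?thesis by simp
    next
      case 2
      have "\<delta>\<^sup>2 \<le> 1" using assms x by (simp add: power_le_one)
      moreover have "d x = d (1 / 2)" using 2 by (simp only:)
      ultimately show ?thesis using pos by (simp add: mult_le_cancel_right1)
    next
      case 3
      have "\<delta>\<^sup>2 * d x \<le> (1 - x)\<^sup>2 * d x"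
        using assms pos by (intro mult_right_mono power_mono) auto
      with koebe_distortion_right[of "1 / 2" x] x 3 show ?thesis by simp
    qed
  qed
  then show ?thesis using assms by (simp add: field_simps)
qed

end

text \<open>The clauses bound \<open>d\<close> by quotients of image lengths and domain lengths.
  Such quotients multiply under composition, and the intermediate lengths \<open>A\<close>,
  \<open>B\<close>, \<open>C\<close> cancel. If the inner map reverses orientation, the outer
  inequality is applied to the reversed triple.\<close>

lemma koebe_pair_compose:
  assumes \<psi>: "koebe_pair \<psi> d" and \<phi>: "koebe_pair \<phi> e"
  shows "koebe_pair (\<lambda>x. \<phi> (\<psi> x)) (\<lambda>x. d x * e (\<psi> x))"
  unfolding koebe_pair_def
proof (intro conjI allI impI)
  show "(\<lambda>x. \<phi> (\<psi> x)) ` {0..1} \<subseteq> {0..1}"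
    using koebe_pair_range[OF \<psi>] koebe_pair_range[OF \<phi>] by auto
  show "(\<forall>x y. 0 \<le> x \<longrightarrow> x < y \<longrightarrow> y \<le> 1 \<longrightarrow> \<phi> (\<psi> x) < \<phi> (\<psi> y)) \<or>
        (\<forall>x y. 0 \<le> x \<longrightarrow> x < y \<longrightarrow> y \<le> 1 \<longrightarrow> \<phi> (\<psi> y) < \<phi> (\<psi> x))"
    using koebe_pair_range[OF \<psi>]
    by (rule_tac koebe_pair_mono[OF \<psi>]; rule_tac koebe_pair_mono[OF \<phi>])
       (smt (verit))+
  show "0 < d x * e (\<psi> x)" if "0 < x" "x < 1" for x
    using that koebe_pair_pos[OF \<psi>] koebe_pair_pos[OF \<phi>] koebe_pair_interior[OF \<psi>] by simp
  show "d y * e (\<psi> y) * ((y - x) * (z - y) * \<bar>\<phi> (\<psi> z) - \<phi> (\<psi> x)\<bar>)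
       \<le> (z - x) * \<bar>\<phi> (\<psi> y) - \<phi> (\<psi> x)\<bar> * \<bar>\<phi> (\<psi> z) - \<phi> (\<psi> y)\<bar>"
    if xyz: "0 \<le> x" "x < y" "y < z" "z \<le> 1" for x y z
  proof -
    define A B C where "A = \<bar>\<psi> y - \<psi> x\<bar>" and "B = \<bar>\<psi> z - \<psi> y\<bar>" and "C = \<bar>\<psi> z - \<psi> x\<bar>"
    have pos: "0 < A" "0 < B" "0 < C"
      using koebe_pair_neq[OF \<psi>, of x y] koebe_pair_neq[OF \<psi>, of y z]
        koebe_pair_neq[OF \<psi>, of x z] xyz
      by (auto simp: A_def B_def C_def)
    define A' B' C' where "A' = \<bar>\<phi> (\<psi> y) - \<phi> (\<psi> x)\<bar>" and "B' = \<bar>\<phi> (\<psi> z) - \<phi> (\<psi> y)\<bar>"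
      and "C' = \<bar>\<phi> (\<psi> z) - \<phi> (\<psi> x)\<bar>"
    have y: "0 < y" "y < 1" using xyz by auto
    have dpos: "0 < d y" "0 < e (\<psi> y)"
      using koebe_pair_pos[OF \<psi>] koebe_pair_pos[OF \<phi>] koebe_pair_interior[OF \<psi>] y by auto
    have 1: "d y * ((y - x) * (z - y) * C) \<le> (z - x) * A * B"
      unfolding A_def B_def C_def by (rule koebe_pair_cross_ratio[OF \<psi> xyz])
    have 2: "e (\<psi> y) * (A * B * C') \<le> C * A' * B'"
    proof -
      have r: "0 \<le> \<psi> x" "\<psi> x \<le> 1" "0 \<le> \<psi> z" "\<psi> z \<le> 1"
        using koebe_pair_range[OF \<psi>, of x] koebe_pair_range[OF \<psi>, of z] xyz by auto
      have "\<psi> x < \<psi> y \<and> \<psi> y < \<psi> z \<or> \<psi> z < \<psi> y \<and> \<psi> y < \<psi> x"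
        using xyz by (rule_tac koebe_pair_mono[OF \<psi>]) auto
      then show ?thesis
      proof
        assume *: "\<psi> x < \<psi> y \<and> \<psi> y < \<psi> z"
        show ?thesis
          using koebe_pair_cross_ratio[OF \<phi>, of "\<psi> x" "\<psi> y" "\<psi> z"] * r
          by (simp add: A_def B_def C_def A'_def B'_def C'_def)
      next
        assume *: "\<psi> z < \<psi> y \<and> \<psi> y < \<psi> x"
        show ?thesis
          using koebe_pair_cross_ratio[OF \<phi>, of "\<psi> z" "\<psi> y" "\<psi> x"] * r
          by (simp add: A_def B_def C_def A'_def B'_def C'_def abs_minus_commute mult_ac)
      qed
    qed
    have "(d y * ((y - x) * (z - y) * C)) * (e (\<psi> y) * (A * B * C'))
        \<le> ((z - x) * A * B) * (C * A' * B')"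
      using xyz pos dpos by (intro mult_mono 1 2) (auto simp: A'_def B'_def C'_def)
    then have "(d y * e (\<psi> y) * ((y - x) * (z - y) * C')) * (A * B * C)
        \<le> ((z - x) * A' * B') * (A * B * C)"
      by (simp only: mult_ac)
    moreover have "0 < A * B * C" using pos by simp
    ultimately show ?thesis unfolding A'_def B'_def C'_def by (rule mult_right_le_imp_le)
  qed
  show "(\<phi> (\<psi> y) - \<phi> (\<psi> x))\<^sup>2 \<le> d x * e (\<psi> x) * (d y * e (\<psi> y)) * (y - x)\<^sup>2"
    if xy: "0 < x" "x < y" "y < 1" for x y
  proof -
    note i = koebe_pair_interior[OF \<psi>, of x] koebe_pair_interior[OF \<psi>, of y]
    have pos: "0 < e (\<psi> x)" "0 < e (\<psi> y)" using xy i koebe_pair_pos[OF \<phi>] by auto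
    have "(\<phi> (\<psi> y) - \<phi> (\<psi> x))\<^sup>2 \<le> e (\<psi> x) * e (\<psi> y) * (\<psi> y - \<psi> x)\<^sup>2"
      using koebe_pair_secant[OF \<phi>, of "\<psi> x" "\<psi> y"] koebe_pair_secant[OF \<phi>, of "\<psi> y" "\<psi> x"]
        koebe_pair_neq[OF \<psi>, of x y] xy i
      by (cases "\<psi> x < \<psi> y") (auto simp: power2_commute mult_ac)
    also have "\<dots> \<le> e (\<psi> x) * e (\<psi> y) * (d x * d y * (y - x)\<^sup>2)"
      using koebe_pair_secant[OF \<psi> xy] pos by (intro mult_left_mono) auto
    finally show ?thesis by (simp add: mult_ac)
  qed
qed

lemma nonvanishing_const_sign:
  fixes u :: "real \<Rightarrow> real"
  assumes "continuous_on {a<..<b} u" "\<And>z. a < z \<Longrightarrow> z < b \<Longrightarrow> u z \<noteq> 0"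
  obtains \<sigma> :: real where "\<sigma> = 1 \<or> \<sigma> = - 1" "\<And>z. a < z \<Longrightarrow> z < b \<Longrightarrow> 0 < \<sigma> * u z"
proof -
  have conn: "connected (u ` {a<..<b})" using assms(1) by (intro connected_continuous_image) auto
  have no0: "0 \<notin> u ` {a<..<b}" using assms(2) by auto
  show ?thesis
  proof (cases "\<exists>z. a < z \<and> z < b \<and> u z > 0")
    case True
    then obtain z where z: "a < z" "z < b" "u z > 0" by auto
    have "0 < 1 * u w" if "a < w" "w < b" for w
    proof (rule ccontr)
      assume "\<not> 0 < 1 * u w"
      then have "{u w..u z} \<subseteq> u ` {a<..<b}"
        using z that by (intro connected_contains_Icc[OF conn]) auto
      then show False using no0 \<open>\<not> 0 < 1 * u w\<close> z by (auto simp: subset_eq)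
    qed
    then show ?thesis using that[of 1] by blast
  next
    case False
    then have "0 < - 1 * u w" if "a < w" "w < b" for w
      using assms(2)[of w] that by force
    then show ?thesis using that[of "- 1"] by blast
  qed
qed

lemma nderiv_in_has_real_derivative:
  assumes "Ck_on n {a..b} f" "j < n" "a < z" "z < b"
  shows "(nderiv_in j {a..b} f has_real_derivative nderiv_in (Suc j) {a..b} f z) (at z)"
proof -
  have "nderiv_in j {a..b} f differentiable (at z within {a..b})"
    using assms unfolding Ck_on_def by (auto simp: differentiable_on_def)
  then have "(nderiv_in j {a..b} f has_vector_derivative nderiv_in (Suc j) {a..b} f z)
      (at z within {a..b})"
    by (simp add: vector_derivative_works nderiv_in_def)
  then show ?thesis
    using assms at_within_Icc_at[of a z b]
    by (simp add: has_real_derivative_iff_has_vector_derivative)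
qed

text \<open>Multiplication by the sign \<open>\<sigma>\<close> reduces to increasing maps, since the
  Schwarzian derivative is unchanged by a constant factor. Read at the points
  \<open>\<psi> x\<close>, the inequalities for \<open>f\<close> become those for its inverse. At a
  critical value division by 0 gives 0, but \<open>koebe_pair\<close> evaluates \<open>d\<close> at
  interior points only.\<close>

lemma the_inv_into_koebe_pair:
  assumes D: "D = {a..b}" "0 \<le> a" "a < b" "b \<le> 1"
    and Ck: "Ck_on 3 D f" and inj: "inj_on f D" and onto: "f ` D = {0..1}"
    and nz: "\<And>z. a < z \<Longrightarrow> z < b \<Longrightarrow> deriv_in D f z \<noteq> 0"
    and schw: "\<And>z. z \<in> D \<Longrightarrow> deriv_in D f z \<noteq> 0 \<Longrightarrow> schwarzian D f z < 0"
  shows "koebe_pair (the_inv_into D f) (\<lambda>x. 1 / \<bar>deriv_in D f (the_inv_into D f x)\<bar>)"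
proof -
  define \<psi> where "\<psi> = the_inv_into D f"
  define u where "u = deriv_in D f"
  define u1 where "u1 = nderiv_in 2 D f"
  define u2 where "u2 = nderiv_in 3 D f"
  have n: "nderiv_in 0 D f = f" "nderiv_in (Suc 0) D f = u" by (auto simp: nderiv_in_def u_def)
  have der: "(f has_real_derivative u z) (at z)"
    and der1: "(u has_real_derivative u1 z) (at z)"
    and der2: "(u1 has_real_derivative u2 z) (at z)" if "a < z" "z < b" for z
    using nderiv_in_has_real_derivative[OF Ck[unfolded D(1)], of 0 z]
      nderiv_in_has_real_derivative[OF Ck[unfolded D(1)], of 1 z]
      nderiv_in_has_real_derivative[OF Ck[unfolded D(1)], of 2 z] that
    by (auto simp: n u1_def u2_def numeral_2_eq_2 numeral_3_eq_3 simp flip: D(1))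
  have cont: "continuous_on {a..b} f"
    using Ck n differentiable_imp_continuous_on unfolding Ck_on_def D(1)
    by (metis zero_less_numeral)
  have "continuous_on {a<..<b} u"
    using der1 by (intro DERIV_continuous_on) (auto intro: has_field_derivative_at_within)
  then obtain \<sigma> :: real where \<sigma>: "\<sigma> = 1 \<or> \<sigma> = - 1" "\<And>z. a < z \<Longrightarrow> z < b \<Longrightarrow> 0 < \<sigma> * u z"
    by (rule nonvanishing_const_sign) (use nz in \<open>auto simp: u_def\<close>)
  have \<sigma>2: "\<sigma> * \<sigma> = 1" using \<sigma>(1) by auto
  have schw': "\<sigma> * u2 z / (\<sigma> * u z) - 3 / 2 * (\<sigma> * u1 z / (\<sigma> * u z))\<^sup>2 < 0" if "a < z" "z < b" for z
  proof -
    have "schwarzian D f z < 0" using schw nz that D by auto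
    then have "u2 z / u z - 3 / 2 * (u1 z / u z)\<^sup>2 < 0"
      using n(2) by (simp only: schwarzian_def u1_def u2_def One_nat_def)
    moreover have "\<sigma> * v / (\<sigma> * w) = v / w" for v w using \<sigma>(1) by auto
    ultimately show ?thesis by (simp only:)
  qed
  have cont': "continuous_on {a..b} (\<lambda>z. \<sigma> * f z)" using cont by (intro continuous_intros)
  note F = cont' DERIV_cmult[OF der] DERIV_cmult[OF der1] DERIV_cmult[OF der2] \<sigma>(2) schw'
  have inc: "\<sigma> * f x < \<sigma> * f y" if "a \<le> x" "x < y" "y \<le> b" for x y
    using increments_pos[OF F that] .
  have sec: "\<bar>u x\<bar> * \<bar>u y\<bar> * (y - x)\<^sup>2 \<le> (f y - f x)\<^sup>2" if xy: "a < x" "x < y" "y < b" for x y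
  proof -
    have "(\<sigma> * u x) * (\<sigma> * u y) * (y - x)\<^sup>2 \<le> (\<sigma> * f y - \<sigma> * f x)\<^sup>2"
      using secant_bound[OF F xy] .
    moreover have "\<sigma> * u x = \<bar>u x\<bar>" "\<sigma> * u y = \<bar>u y\<bar>" using \<sigma>(1) \<sigma>(2)[of x] \<sigma>(2)[of y] xy by auto
    moreover have "(\<sigma> * f y - \<sigma> * f x)\<^sup>2 = (f y - f x)\<^sup>2" using \<sigma>(1) by (auto simp: power2_eq_square algebra_simps)
    ultimately show ?thesis by simp
  qed
  have cr: "\<bar>f y - f x\<bar> * \<bar>f z - f y\<bar> * (z - x) \<le> \<bar>u y\<bar> * \<bar>f z - f x\<bar> * (y - x) * (z - y)"
    if xyz: "a \<le> x" "x < y" "y < z" "z \<le> b" for x y z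
  proof -
    have *: "\<sigma> * f v - \<sigma> * f w = \<bar>f v - f w\<bar>" if "a \<le> w" "w < v" "v \<le> b" for v w
      using inc[OF that] \<sigma>(1) by auto
    have "\<sigma> * u y = \<bar>u y\<bar>" using \<sigma>(1) \<sigma>(2)[of y] xyz by auto
    then show ?thesis
      using cross_ratio_bound[OF F xyz] xyz by (simp add: *)
  qed
  have \<psi>: "\<psi> x \<in> {a..b}" "f (\<psi> x) = x" if "0 \<le> x" "x \<le> 1" for x
  proof -
    have "x \<in> f ` D" using onto that by simp
    then show "\<psi> x \<in> {a..b}" "f (\<psi> x) = x"
      using the_inv_into_into[OF inj, of x D] f_the_inv_into_f[OF inj] D(1) by (auto simp: \<psi>_def)
  qed
  have \<psi>_less: "if \<sigma> = 1 then \<psi> x < \<psi> y else \<psi> y < \<psi> x" if "0 \<le> x" "x < y" "y \<le> 1" for x y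
  proof -
    have "\<psi> x \<noteq> \<psi> y" "\<psi> x \<in> {a..b}" "\<psi> y \<in> {a..b}" using \<psi>[of x] \<psi>[of y] that by auto
    then show ?thesis
      using inc[of "\<psi> x" "\<psi> y"] inc[of "\<psi> y" "\<psi> x"] \<psi>(2)[of x] \<psi>(2)[of y] that \<sigma>(1) by force
  qed
  have \<psi>_int: "a < \<psi> x" "\<psi> x < b" if "0 < x" "x < 1" for x
    using \<psi>_less[of 0 x] \<psi>_less[of x 1] \<psi>[of 0] \<psi>[of 1] \<psi>[of x] that by (auto split: if_splits)
  have upos: "0 < \<bar>u (\<psi> x)\<bar>" if "0 < x" "x < 1" for x
    using \<sigma>(2)[OF \<psi>_int[OF that]] by auto
  have "koebe_pair \<psi> (\<lambda>x. 1 / \<bar>u (\<psi> x)\<bar>)"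
    unfolding koebe_pair_def
  proof (intro conjI allI impI)
    show "\<psi> ` {0..1} \<subseteq> {0..1}" using \<psi>(1) D by force
    show "(\<forall>x y. 0 \<le> x \<longrightarrow> x < y \<longrightarrow> y \<le> 1 \<longrightarrow> \<psi> x < \<psi> y) \<or>
      (\<forall>x y. 0 \<le> x \<longrightarrow> x < y \<longrightarrow> y \<le> 1 \<longrightarrow> \<psi> y < \<psi> x)"
      using \<psi>_less by (cases "\<sigma> = 1") auto
    show "0 < 1 / \<bar>u (\<psi> x)\<bar>" if "0 < x" "x < 1" for x using upos[OF that] by simp
    show "1 / \<bar>u (\<psi> y)\<bar> * ((y - x) * (z - y) * \<bar>\<psi> z - \<psi> x\<bar>)
        \<le> (z - x) * \<bar>\<psi> y - \<psi> x\<bar> * \<bar>\<psi> z - \<psi> y\<bar>"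
      if xyz: "0 \<le> x" "x < y" "y < z" "z \<le> 1" for x y z
    proof -
      have fx: "f (\<psi> x) = x" "f (\<psi> y) = y" "f (\<psi> z) = z" using \<psi>(2) xyz by auto
      have r: "\<psi> x \<in> {a..b}" "\<psi> z \<in> {a..b}" using \<psi>(1) xyz by auto
      have up: "0 < \<bar>u (\<psi> y)\<bar>" using upos xyz by auto
      have "(y - x) * (z - y) * \<bar>\<psi> z - \<psi> x\<bar> \<le> \<bar>u (\<psi> y)\<bar> * ((z - x) * \<bar>\<psi> y - \<psi> x\<bar> * \<bar>\<psi> z - \<psi> y\<bar>)"
      proof (cases "\<sigma> = 1")
        case True
        then have "\<psi> x < \<psi> y" "\<psi> y < \<psi> z" using \<psi>_less[of x y] \<psi>_less[of y z] xyz by auto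
        then show ?thesis
          using cr[of "\<psi> x" "\<psi> y" "\<psi> z"] r xyz by (simp add: fx mult_ac)
      next
        case False
        then have "\<psi> z < \<psi> y" "\<psi> y < \<psi> x" using \<psi>_less[of x y] \<psi>_less[of y z] xyz by auto
        then show ?thesis
          using cr[of "\<psi> z" "\<psi> y" "\<psi> x"] r xyz by (simp add: fx mult_ac abs_minus_commute)
      qed
      then show ?thesis using up by (simp add: pos_divide_le_eq mult_ac)
    qed
    show "(\<psi> y - \<psi> x)\<^sup>2 \<le> 1 / \<bar>u (\<psi> x)\<bar> * (1 / \<bar>u (\<psi> y)\<bar>) * (y - x)\<^sup>2"
      if xy: "0 < x" "x < y" "y < 1" for x y
    proof -
      have fx: "f (\<psi> x) = x" "f (\<psi> y) = y" using \<psi>(2) xy by auto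
      have up: "0 < \<bar>u (\<psi> x)\<bar>" "0 < \<bar>u (\<psi> y)\<bar>" using upos xy by auto
      have "\<bar>u (\<psi> x)\<bar> * \<bar>u (\<psi> y)\<bar> * (\<psi> y - \<psi> x)\<^sup>2 \<le> (y - x)\<^sup>2"
        using sec[of "\<psi> x" "\<psi> y"] sec[of "\<psi> y" "\<psi> x"] \<psi>_int[of x] \<psi>_int[of y] \<psi>_less[of x y] xy
        by (auto simp: fx power2_commute mult_ac split: if_splits)
      then show ?thesis using up by (simp add: pos_le_divide_eq mult_ac)
    qed
  qed
  then show ?thesis by (simp add: \<psi>_def u_def)
qed

section \<open>Inverse branches and truncated Julia sets\<close>

context random_critically_finite_map
begin

abbreviation \<G> :: "real set set" where "\<G> \<equiv> GC \<union> GE"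

abbreviation inv_br :: "real set \<Rightarrow> 'w \<Rightarrow> real \<Rightarrow> real" where
  "inv_br D \<omega> \<equiv> the_inv_into D (T \<omega>)"

abbreviation Jul :: "nat \<Rightarrow> 'w \<Rightarrow> real set" where
  "Jul k \<omega> \<equiv> trunc_julia \<theta> T \<G> D0 k \<omega>"

abbreviation cut :: "nat \<Rightarrow> 'w \<Rightarrow> real" where
  "cut k \<omega> \<equiv> inv_branch0 \<theta> T D0 k \<omega> 1"

abbreviation trop :: "real \<Rightarrow> nat \<Rightarrow> 'w \<Rightarrow> (real \<Rightarrow> real) \<Rightarrow> real \<Rightarrow> real" where
  "trop t k \<omega> \<equiv> transfer_op \<theta> T \<G> D0 t k \<omega>"

lemma theta_space: "\<omega> \<in> space M \<Longrightarrow> \<theta> \<omega> \<in> space M"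
  using theta_measurable by (rule measurable_space)

lemma theta_pow_space: "\<omega> \<in> space M \<Longrightarrow> (\<theta> ^^ n) \<omega> \<in> space M"
  by (induction n) (auto intro: theta_space)

lemma finite_G: "finite \<G>" using finite_GC finite_GE by simp

lemma G_interval:
  assumes "D \<in> \<G>"
  obtains a b where "0 \<le> a" "a < b" "b \<le> 1" "D = {a..b}"
  using intervals[OF assms] by blast

lemma G_subset_unit: "D \<in> \<G> \<Longrightarrow> D \<subseteq> {0..1}"
  by (erule G_interval) auto

context
  fixes \<omega> assumes \<omega>: "\<omega> \<in> space M"
begin

lemma
  shows T_cont_Union: "continuous_on (\<Union>\<G>) (T \<omega>)"
    and T_branches: "\<forall>D\<in>\<G>. Ck_on 3 D (T \<omega>) \<and> inj_on (T \<omega>) D \<and> T \<omega> ` D = {0..1} \<and>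
      (\<forall>x\<in>D. deriv_in D (T \<omega>) x \<noteq> 0 \<longrightarrow> schwarzian D (T \<omega>) x < 0)"
    and T_expanding: "\<forall>D\<in>GE. \<forall>x\<in>D. \<kappa> \<le> \<bar>deriv_in D (T \<omega>) x\<bar>"
    and T_critical: "\<forall>D\<in>GC. c D \<in> D \<and> c D \<in> frontier D \<and>
      (\<forall>x\<in>D. deriv_in D (T \<omega>) x = 0 \<longleftrightarrow> x = c D)"
    and T_0: "T \<omega> 0 = 0" and T_1: "T \<omega> 1 = 0"
    and T_deriv_0: "\<kappa> \<le> deriv_in D0 (T \<omega>) 0"
    and T_deriv_bound: "\<forall>D\<in>\<G>. \<forall>x\<in>D. \<bar>deriv_in D (T \<omega>) x\<bar> \<le> A"
  using T_in_class[OF \<omega>] unfolding critically_finite_class_def mem_Collect_eq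
  by - (elim conjE, assumption)+

lemma T_cont: "D \<in> \<G> \<Longrightarrow> continuous_on D (T \<omega>)"
  by (rule continuous_on_subset[OF T_cont_Union]) auto

lemma T_onto: "D \<in> \<G> \<Longrightarrow> T \<omega> ` D = {0..1}"
  and T_inj: "D \<in> \<G> \<Longrightarrow> inj_on (T \<omega>) D"
  and T_Ck: "D \<in> \<G> \<Longrightarrow> Ck_on 3 D (T \<omega>)"
  using T_branches by simp_all

lemma T_schwarzian: "D \<in> \<G> \<Longrightarrow> x \<in> D \<Longrightarrow> deriv_in D (T \<omega>) x \<noteq> 0 \<Longrightarrow> schwarzian D (T \<omega>) x < 0"
  using T_branches by simp

lemma T_deriv_le: "D \<in> \<G> \<Longrightarrow> x \<in> D \<Longrightarrow> \<bar>deriv_in D (T \<omega>) x\<bar> \<le> A"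
  using T_deriv_bound by blast

lemma T_deriv_nonzero:
  assumes D: "D \<in> \<G>" "D = {a..b}" and z: "a < z" "z < b"
  shows "deriv_in D (T \<omega>) z \<noteq> 0"
proof (cases "D \<in> GE")
  case True
  then have "\<kappa> \<le> \<bar>deriv_in D (T \<omega>) z\<bar>"
    using T_expanding D(2) z by auto
  then show ?thesis using kappa_gt_1 by auto
next
  case False
  then have "D \<in> GC" using D by auto
  then have "c D \<in> frontier D" "deriv_in D (T \<omega>) z = 0 \<longleftrightarrow> z = c D"
    using T_critical D(2) z by auto
  moreover have "z \<notin> frontier D" using D(2) z by (simp add: frontier_def)
  ultimately show ?thesis by auto
qed

lemma inv_br_koebe:
  assumes D: "D \<in> \<G>"
  shows "koebe_pair (inv_br D \<omega>) (\<lambda>x. 1 / \<bar>deriv_in D (T \<omega>) (inv_br D \<omega> x)\<bar>)"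
proof -
  obtain a b where ab: "0 \<le> a" "a < b" "b \<le> 1" "D = {a..b}" using G_interval[OF D] .
  show ?thesis
    using ab T_Ck[OF D] T_inj[OF D] T_onto[OF D] T_deriv_nonzero[OF D ab(4)] T_schwarzian[OF D]
    by (intro the_inv_into_koebe_pair) auto
qed

lemma inv_br_in: "D \<in> \<G> \<Longrightarrow> 0 \<le> x \<Longrightarrow> x \<le> 1 \<Longrightarrow> inv_br D \<omega> x \<in> D"
  using the_inv_into_into[OF T_inj, of D x D] T_onto[of D] by auto

lemma T_inv_br: "D \<in> \<G> \<Longrightarrow> 0 \<le> x \<Longrightarrow> x \<le> 1 \<Longrightarrow> T \<omega> (inv_br D \<omega> x) = x"
  using f_the_inv_into_f[OF T_inj, of D x] T_onto[of D] by auto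

lemma inv_br_T: "D \<in> \<G> \<Longrightarrow> y \<in> D \<Longrightarrow> inv_br D \<omega> (T \<omega> y) = y"
  using the_inv_into_f_f[OF T_inj] by blast

lemma T_has_deriv:
  assumes "D \<in> \<G>" "x \<in> D"
  shows "(T \<omega> has_real_derivative deriv_in D (T \<omega>) x) (at x within D)"
proof -
  have "nderiv_in 0 D (T \<omega>) differentiable_on D"
    using T_Ck[OF assms(1)] unfolding Ck_on_def by (metis zero_less_numeral)
  then have "T \<omega> differentiable (at x within D)"
    using assms(2) by (auto simp: differentiable_on_def nderiv_in_def)
  then show ?thesis
    by (simp add: vector_derivative_works has_real_derivative_iff_has_vector_derivative)
qed

lemma T_lipschitz:
  assumes "D \<in> \<G>" "x \<in> D" "y \<in> D"
  shows "\<bar>T \<omega> x - T \<omega> y\<bar> \<le> A * \<bar>x - y\<bar>"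
proof -
  have "convex D" using G_interval[OF assms(1)] by (metis convex_real_interval(5))
  then show ?thesis
    using field_differentiable_bound[of D "T \<omega>" "deriv_in D (T \<omega>)" A x y]
      T_has_deriv T_deriv_le assms by auto
qed

lemma inv_br_interior:
  assumes D: "D \<in> \<G>" "D = {a..b}" and x: "0 < x" "x < 1"
  shows "a < inv_br D \<omega> x" "inv_br D \<omega> x < b"
proof -
  have "inv_br D \<omega> 0 \<in> D" "inv_br D \<omega> 1 \<in> D" using inv_br_in[OF D(1)] by auto
  moreover have "inv_br D \<omega> 0 < inv_br D \<omega> x \<and> inv_br D \<omega> x < inv_br D \<omega> 1 \<or>
      inv_br D \<omega> 1 < inv_br D \<omega> x \<and> inv_br D \<omega> x < inv_br D \<omega> 0"
    by (rule koebe_pair_mono[OF inv_br_koebe[OF D(1)]]) (use x in auto)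
  ultimately show "a < inv_br D \<omega> x" "inv_br D \<omega> x < b" using D(2) by auto
qed

text \<open>A decreasing inverse branch would place the image of 1 below that of 0, which is 0
  because \<open>T \<omega>\<close> fixes 0.\<close>

lemma inv_br_D0_less:
  assumes "0 \<le> x" "x < y" "y \<le> 1"
  shows "inv_br D0 \<omega> x < inv_br D0 \<omega> y"
proof (rule koebe_pair_mono[OF inv_br_koebe[OF D0(1)]])
  assume "\<And>x y. 0 \<le> x \<Longrightarrow> x < y \<Longrightarrow> y \<le> 1 \<Longrightarrow> inv_br D0 \<omega> y < inv_br D0 \<omega> x"
  from this[of 0 1] have "inv_br D0 \<omega> 1 < inv_br D0 \<omega> (T \<omega> 0)" by (simp add: T_0)
  then have "inv_br D0 \<omega> 1 < 0" using inv_br_T[OF D0] by simp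
  then have False using inv_br_in[OF D0(1), of 1] G_subset_unit[OF D0(1)] by force
  then show "inv_br D0 \<omega> x < inv_br D0 \<omega> y" ..
qed (use assms in auto)

lemma inv_br_D0_le_iff:
  assumes "0 \<le> x" "x \<le> 1" "0 \<le> y" "y \<le> 1"
  shows "inv_br D0 \<omega> x \<le> inv_br D0 \<omega> y \<longleftrightarrow> x \<le> y"
  using inv_br_D0_less[of x y] inv_br_D0_less[of y x] assms by (cases x y rule: linorder_cases) auto

lemma length_ge: assumes "{a..b} \<in> \<G>" "a < b" shows "1 / A \<le> b - a"
proof -
  have "0 \<in> T \<omega> ` {a..b}" "1 \<in> T \<omega> ` {a..b}" using T_onto[OF assms(1)] by auto
  then obtain x y where xy: "x \<in> {a..b}" "T \<omega> x = 0" "y \<in> {a..b}" "T \<omega> y = 1" by auto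
  have "1 \<le> A * \<bar>x - y\<bar>" using T_lipschitz[OF assms(1), of x y] xy by simp
  also have "\<dots> \<le> A * (b - a)" using xy A_gt_1 by (intro mult_left_mono) auto
  finally show ?thesis using A_gt_1 by (simp add: field_simps)
qed

end

lemma D0_le:
  assumes "D \<in> \<G>" "D \<noteq> D0" "y \<in> D" "z \<in> D0" shows "z \<le> y"
proof -
  obtain a b where ab: "0 \<le> a" "a < b" "b \<le> 1" "D = {a..b}" using G_interval[OF assms(1)] .
  obtain p q where pq: "0 \<le> p" "p < q" "q \<le> 1" "D0 = {p..q}" using G_interval[OF D0(1)] .
  have "p = 0" using D0(2) pq by auto
  have "interior D \<inter> interior D0 = {}"
    using disjoint_interiors assms D0(1) unfolding pairwise_def by blast
  then have dis: "{a<..<b} \<inter> {0<..<q} = {}" using ab(4) pq(4) \<open>p = 0\<close> by simp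
  have "q \<le> a"
  proof (rule ccontr)
    assume "\<not> q \<le> a"
    \<comment> \<open>Midpoint of the common part of the two open intervals.\<close>
    then have "(a + min b q) / 2 \<in> {a<..<b} \<inter> {0<..<q}" using ab pq by (auto simp: min_def)
    then show False using dis by auto
  qed
  then show ?thesis using assms ab(4) pq(4) by auto
qed

lemma D1_ge:
  assumes "D \<in> \<G>" "D \<noteq> D1" "y \<in> D" "z \<in> D1" shows "y \<le> z"
proof -
  obtain a b where ab: "0 \<le> a" "a < b" "b \<le> 1" "D = {a..b}" using G_interval[OF assms(1)] .
  obtain p q where pq: "0 \<le> p" "p < q" "q \<le> 1" "D1 = {p..q}" using G_interval[OF D1(1)] .
  have "q = 1" using D1(2) pq by auto
  have "interior D \<inter> interior D1 = {}"
    using disjoint_interiors assms D1(1) unfolding pairwise_def by blast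
  then have dis: "{a<..<b} \<inter> {p<..<1} = {}" using ab(4) pq(4) \<open>q = 1\<close> by simp
  have "b \<le> p"
  proof (rule ccontr)
    assume "\<not> b \<le> p"
    then have "(b + max a p) / 2 \<in> {a<..<b} \<inter> {p<..<1}" using ab pq by (auto simp: max_def)
    then show False using dis by auto
  qed
  then show ?thesis using assms ab(4) pq(4) by auto
qed

text \<open>Since slopes are at most \<open>A\<close>, each further pullback towards the fixed point
  0 shrinks the distance to it by a factor of at most \<open>A\<close>.\<close>

lemma cut_bounds_conj:
  assumes "\<omega> \<in> space M" shows "(1 / A) ^ k \<le> cut k \<omega> \<and> cut k \<omega> \<le> 1"
  using assms
proof (induction k arbitrary: \<omega>)
  case (Suc k)
  note IH = Suc.IH[OF theta_space[OF Suc.prems]]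
  have A: "0 < (1 / A) ^ k" using A_gt_1 by simp
  let ?y = "inv_br D0 \<omega> (cut k (\<theta> \<omega>))"
  have c: "0 \<le> cut k (\<theta> \<omega>)" "cut k (\<theta> \<omega>) \<le> 1" using IH A by auto
  have y: "?y \<in> D0" "T \<omega> ?y = cut k (\<theta> \<omega>)" "0 \<le> ?y" "?y \<le> 1"
    using inv_br_in[OF Suc.prems D0(1) c] T_inv_br[OF Suc.prems D0(1) c] G_subset_unit[OF D0(1)]
    by auto
  have "cut k (\<theta> \<omega>) \<le> A * ?y"
    using T_lipschitz[OF Suc.prems D0(1) y(1) D0(2)] y c T_0[OF Suc.prems] by simp
  then have "(1 / A) ^ k \<le> A * ?y" using IH by simp
  then have "(1 / A) ^ Suc k \<le> cut (Suc k) \<omega>" using A_gt_1 by (simp add: field_simps)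
  then show ?case using y by simp
qed auto

lemmas cut_bounds = cut_bounds_conj[THEN conjunct1] cut_bounds_conj[THEN conjunct2]

lemma cut_pos: "\<omega> \<in> space M \<Longrightarrow> 0 < cut k \<omega>"
  using cut_bounds(1)[of \<omega> k] A_gt_1 by (smt (verit) zero_less_divide_1_iff zero_less_power)

lemma cut_in_D0:
  assumes "\<omega> \<in> space M" "1 \<le> k" shows "cut k \<omega> \<in> D0"
proof -
  obtain j where "k = Suc j" using assms(2) by (cases k) auto
  then show ?thesis
    using inv_br_in[OF assms(1) D0(1)] cut_pos[OF theta_space[OF assms(1)], of j]
      cut_bounds(2)[OF theta_space[OF assms(1)], of j] by auto
qed

lemma cut_Suc_le:
  assumes "\<omega> \<in> space M" shows "cut (Suc k) \<omega> \<le> cut k \<omega>"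
  using assms
proof (induction k arbitrary: \<omega>)
  case 0
  show ?case using cut_bounds(2)[OF 0, of "Suc 0"] by simp
next
  case (Suc k)
  note \<theta>\<omega> = theta_space[OF Suc.prems]
  have "inv_br D0 \<omega> (cut (Suc k) (\<theta> \<omega>)) \<le> inv_br D0 \<omega> (cut k (\<theta> \<omega>))"
    using Suc.IH[OF \<theta>\<omega>] cut_pos[OF \<theta>\<omega>] cut_bounds(2)[OF \<theta>\<omega>]
    by (subst inv_br_D0_le_iff[OF Suc.prems]) (auto intro: less_imp_le simp del: inv_branch0.simps)
  then show ?case by simp
qed

lemma fibre_iter_Suc_shift:
  "fibre_iter \<theta> T (Suc n) \<omega> x = fibre_iter \<theta> T n (\<theta> \<omega>) (T \<omega> x)"
  by (induction n) (auto simp: funpow_swap1)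

text \<open>One-step description of the truncated sets, which turns arguments along orbits into
  inductions over the shifted base point.\<close>

lemma Jul_iff:
  "x \<in> Jul k \<omega> \<longleftrightarrow> x \<in> \<Union>\<G> \<and> cut k \<omega> \<le> x \<and> x \<le> 1 \<and> T \<omega> x \<in> Jul k (\<theta> \<omega>)"
proof -
  define P where "P n \<longleftrightarrow> fibre_iter \<theta> T n \<omega> x \<in> \<Union>\<G> \<inter> trunc_interval \<theta> T D0 k ((\<theta> ^^ n) \<omega>)" for n
  have "x \<in> Jul k \<omega> \<longleftrightarrow> (\<forall>n. P n)" unfolding P_def trunc_julia_def by blast
  also have "\<dots> \<longleftrightarrow> P 0 \<and> (\<forall>n. P (Suc n))" by (metis not0_implies_Suc)
  also have "P 0 \<longleftrightarrow> x \<in> \<Union>\<G> \<and> cut k \<omega> \<le> x \<and> x \<le> 1"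
    by (auto simp: P_def trunc_interval_def)
  also have "(\<forall>n. P (Suc n)) \<longleftrightarrow> T \<omega> x \<in> Jul k (\<theta> \<omega>)"
    unfolding P_def fibre_iter_Suc_shift trunc_julia_def by (simp add: funpow_swap1)
  finally show ?thesis by blast
qed

lemma Jul_Suc_subset:
  assumes "\<omega> \<in> space M" shows "Jul k \<omega> \<subseteq> Jul (Suc k) \<omega>"
proof -
  have "trunc_interval \<theta> T D0 k ((\<theta> ^^ n) \<omega>) \<subseteq> trunc_interval \<theta> T D0 (Suc k) ((\<theta> ^^ n) \<omega>)" for n
    using cut_Suc_le[OF theta_pow_space[OF assms], of k n] by (simp del: inv_branch0.simps add: trunc_interval_def)
  then show ?thesis unfolding trunc_julia_def by blast
qed

text \<open>The cut gives the lower bound. A point of \<open>D1\<close> close to 1 is mapped close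
  to 0, below the cut of the next fibre, which costs one more factor \<open>A\<close>; points
  outside \<open>D1\<close> keep from 1 at least the length of \<open>D1\<close>, which is no less
  than \<open>1 / A\<close>.\<close>

lemma Jul_bounds:
  assumes \<omega>: "\<omega> \<in> space M" and x: "x \<in> Jul k \<omega>"
  shows "(1 / A) ^ Suc k \<le> x" "x \<le> 1 - (1 / A) ^ Suc k"
proof -
  have A1: "(1 / A) ^ Suc k \<le> (1 / A) ^ k" using A_gt_1 by (intro power_decreasing) auto
  have x1: "x \<in> \<Union>\<G>" "cut k \<omega> \<le> x" "x \<le> 1" "T \<omega> x \<in> Jul k (\<theta> \<omega>)" using x Jul_iff by blast+
  show "(1 / A) ^ Suc k \<le> x" using cut_bounds(1)[OF \<omega>, of k] x1 A1 by linarith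
  show "x \<le> 1 - (1 / A) ^ Suc k"
  proof (cases "x \<in> D1")
    case True
    have "cut k (\<theta> \<omega>) \<le> T \<omega> x" using x1(4) Jul_iff by blast
    then have "(1 / A) ^ k \<le> T \<omega> x" using cut_bounds(1)[OF theta_space[OF \<omega>], of k] by linarith
    also have "T \<omega> x \<le> A * (1 - x)"
      using T_lipschitz[OF \<omega> D1(1) True D1(2)] T_1[OF \<omega>] x1(3) by auto
    finally show ?thesis using A_gt_1 by (simp add: field_simps)
  next
    case False
    obtain p q where pq: "0 \<le> p" "p < q" "q \<le> 1" "D1 = {p..q}" using G_interval[OF D1(1)] .
    have "q = 1" using D1(2) pq by auto
    obtain D where "D \<in> \<G>" "x \<in> D" using x1 by auto
    moreover have "p \<in> D1" using pq by simp
    ultimately have "x \<le> p" using D1_ge[of D x p] False by blast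
    moreover have "1 / A \<le> 1 - p" using length_ge[OF \<omega>, of p 1] D1(1) pq \<open>q = 1\<close> by auto
    moreover have "(1 / A) ^ Suc k \<le> (1 / A) ^ 1" using A_gt_1 by (intro power_decreasing) auto
    ultimately show ?thesis by simp
  qed
qed

lemma Jul_open_unit:
  assumes "\<omega> \<in> space M" "x \<in> Jul k \<omega>" shows "0 < x" "x < 1"
proof -
  have "0 < (1 / A) ^ Suc k" using A_gt_1 by simp
  then show "0 < x" "x < 1" using Jul_bounds[OF assms] by linarith+
qed

lemma inv_br_Jul_imp:
  assumes "\<omega> \<in> space M" "D \<in> \<G>" "0 \<le> x" "x \<le> 1" "inv_br D \<omega> x \<in> Jul k \<omega>"
  shows "x \<in> Jul k (\<theta> \<omega>)"
  using assms Jul_iff[of "inv_br D \<omega> x" k \<omega>] T_inv_br[OF assms(1-4)] by simp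

lemma inv_br_Jul_iff:
  assumes \<omega>: "\<omega> \<in> space M" and D: "D \<in> \<G>" and x: "x \<in> Jul k (\<theta> \<omega>)"
  shows "inv_br D \<omega> x \<in> Jul k \<omega> \<longleftrightarrow> cut k \<omega> \<le> inv_br D \<omega> x"
proof -
  have x01: "0 \<le> x" "x \<le> 1" using Jul_open_unit[OF theta_space[OF \<omega>] x] by auto
  show ?thesis
    using Jul_iff[of "inv_br D \<omega> x" k \<omega>] T_inv_br[OF \<omega> D x01] inv_br_in[OF \<omega> D x01]
      G_subset_unit[OF D] D x by auto
qed

text \<open>The cut lies in the leftmost interval \<open>D0\<close>, so truncation can exclude
  branches into \<open>D0\<close> only.\<close>

lemma cut_le_inv_br:
  assumes \<omega>: "\<omega> \<in> space M" and D: "D \<in> \<G>" "D \<noteq> D0" and x: "0 \<le> x" "x \<le> 1" and k: "1 \<le> k"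
  shows "cut k \<omega> \<le> inv_br D \<omega> x"
  using D0_le[OF D inv_br_in[OF \<omega> D(1) x] cut_in_D0[OF \<omega> k]] .

text \<open>Each symbol \<open>D0\<close> consumes one level of the cut; in this way truncation
  bounds the runs of \<open>D0\<close>.\<close>

lemma cut_Suc_le_inv_br_D0:
  assumes \<omega>: "\<omega> \<in> space M" and x: "0 \<le> x" "x \<le> 1"
  shows "cut (Suc k) \<omega> \<le> inv_br D0 \<omega> x \<longleftrightarrow> cut k (\<theta> \<omega>) \<le> x"
  using inv_br_D0_le_iff[OF \<omega>, of "cut k (\<theta> \<omega>)" x] x cut_pos[OF theta_space[OF \<omega>], of k]
    cut_bounds(2)[OF theta_space[OF \<omega>], of k] by simp

lemma inv_br_deriv:
  assumes \<omega>: "\<omega> \<in> space M" and D: "D \<in> \<G>" and x: "0 < x" "x < 1"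
  shows "deriv_in (\<Union>\<G>) (T \<omega>) (inv_br D \<omega> x) = deriv_in D (T \<omega>) (inv_br D \<omega> x)"
proof -
  obtain a b where ab: "0 \<le> a" "a < b" "b \<le> 1" "D = {a..b}" using G_interval[OF D] .
  have 1: "inv_br D \<omega> x \<in> interior D" using inv_br_interior[OF \<omega> D ab(4) x] ab(4) by simp
  moreover have "interior D \<subseteq> interior (\<Union>\<G>)" using D by (intro interior_mono) auto
  ultimately have 2: "inv_br D \<omega> x \<in> interior (\<Union>\<G>)" by (rule subsetD[rotated])
  show ?thesis by (simp only: at_within_interior[OF 1] at_within_interior[OF 2])
qed

lemma inv_br_eq_imp:
  assumes \<omega>: "\<omega> \<in> space M" and D: "D \<in> \<G>" "E \<in> \<G>" and x: "0 < x" "x < 1"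
    and eq: "inv_br D \<omega> x = inv_br E \<omega> x"
  shows "D = E"
proof (rule ccontr)
  assume "D \<noteq> E"
  then have "interior D \<inter> interior E = {}"
    using disjoint_interiors D unfolding pairwise_def by blast
  moreover have "inv_br F \<omega> x \<in> interior F" if F: "F \<in> \<G>" for F
  proof -
    obtain a b where ab: "0 \<le> a" "a < b" "b \<le> 1" "F = {a..b}" using G_interval[OF F] .
    show ?thesis using inv_br_interior[OF \<omega> F ab(4) x] ab(4) by simp
  qed
  ultimately show False using D eq by (metis disjoint_iff)
qed

text \<open>Over the open unit interval preimages in different intervals are different, as common
  endpoints are mapped into \<open>{0, 1}\<close>. The sum over preimages thus becomes a sum over
  the fixed finite set \<open>\<G>\<close>, with the dependence of the index set on \<open>x\<close>
  moved into an indicator.\<close>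

lemma trop_eq:
  assumes \<omega>: "\<omega> \<in> space M" and x: "0 < x" "x < 1"
  shows "trop t k \<omega> g x = (\<Sum>D\<in>\<G>. if inv_br D \<omega> x \<in> Jul k \<omega>
      then g (inv_br D \<omega> x) * \<bar>deriv_in D (T \<omega>) (inv_br D \<omega> x)\<bar> powr (- t) else 0)"
proof -
  have x': "0 \<le> x" "x \<le> 1" using x by auto
  have bij: "bij_betw (\<lambda>D. inv_br D \<omega> x) {D \<in> \<G>. inv_br D \<omega> x \<in> Jul k \<omega>} {y \<in> Jul k \<omega>. T \<omega> y = x}"
    unfolding bij_betw_def
  proof
    show "inj_on (\<lambda>D. inv_br D \<omega> x) {D \<in> \<G>. inv_br D \<omega> x \<in> Jul k \<omega>}"
      using inv_br_eq_imp[OF \<omega> _ _ x] by (intro inj_onI) blast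
    show "(\<lambda>D. inv_br D \<omega> x) ` {D \<in> \<G>. inv_br D \<omega> x \<in> Jul k \<omega>} = {y \<in> Jul k \<omega>. T \<omega> y = x}"
    proof (intro equalityI subsetI)
      fix y assume y: "y \<in> {y \<in> Jul k \<omega>. T \<omega> y = x}"
      then have "y \<in> \<Union>\<G>" using Jul_iff by blast
      then obtain D where D: "D \<in> \<G>" "y \<in> D" by blast
      then have "y = inv_br D \<omega> x" using inv_br_T[OF \<omega> D] y by simp
      then show "y \<in> (\<lambda>D. inv_br D \<omega> x) ` {D \<in> \<G>. inv_br D \<omega> x \<in> Jul k \<omega>}"
        using D y by blast
    qed (use T_inv_br[OF \<omega> _ x'] in blast)
  qed
  have "trop t k \<omega> g x = (\<Sum>D | D \<in> \<G> \<and> inv_br D \<omega> x \<in> Jul k \<omega>.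
      g (inv_br D \<omega> x) * \<bar>deriv_in (\<Union>\<G>) (T \<omega>) (inv_br D \<omega> x)\<bar> powr (- t))"
    unfolding transfer_op_def by (rule sum.reindex_bij_betw[OF bij, symmetric])
  also have "\<dots> = (\<Sum>D | D \<in> \<G> \<and> inv_br D \<omega> x \<in> Jul k \<omega>.
      g (inv_br D \<omega> x) * \<bar>deriv_in D (T \<omega>) (inv_br D \<omega> x)\<bar> powr (- t))"
    using inv_br_deriv[OF \<omega> _ x] by (intro sum.cong) auto
  also have "\<dots> = (\<Sum>D\<in>\<G>. if inv_br D \<omega> x \<in> Jul k \<omega>
      then g (inv_br D \<omega> x) * \<bar>deriv_in D (T \<omega>) (inv_br D \<omega> x)\<bar> powr (- t) else 0)"
    using finite_G by (simp only: sum.inter_filter)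
  finally show ?thesis .
qed

section \<open>Branches along words and iterated transfer operators\<close>

primrec branch :: "real set list \<Rightarrow> 'w \<Rightarrow> real \<Rightarrow> real" where
  "branch [] \<omega> x = x"
| "branch (D # w) \<omega> x = inv_br D \<omega> (branch w (\<theta> \<omega>) x)"

text \<open>The chain-rule product for the modulus of the derivative of
  \<open>branch w \<omega>\<close>, in the shape delivered by \<open>koebe_pair_compose\<close>. The
  head of a word is the first interval visited by the orbit, so its inverse branch is applied
  last.\<close>

primrec bderiv :: "real set list \<Rightarrow> 'w \<Rightarrow> real \<Rightarrow> real" where
  "bderiv [] \<omega> x = 1"
| "bderiv (D # w) \<omega> x =
     bderiv w (\<theta> \<omega>) x * (1 / \<bar>deriv_in D (T \<omega>) (inv_br D \<omega> (branch w (\<theta> \<omega>) x))\<bar>)"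

definition words :: "nat \<Rightarrow> real set list set" where
  "words n = {w. set w \<subseteq> \<G> \<and> length w = n}"

lemma finite_words: "finite (words n)"
  unfolding words_def using finite_G by (rule finite_lists_length_eq)

lemma card_words: "card (words n) = card \<G> ^ n"
  unfolding words_def using finite_G by (rule card_lists_length_eq)

lemma words_Suc: "words (Suc n) = (\<lambda>(D, w). D # w) ` (\<G> \<times> words n)"
  unfolding words_def by (force simp: length_Suc_conv)

text \<open>The clauses of \<open>koebe_pair\<close> contain no constants, so composition loses
  nothing and distortion is controlled uniformly in the length of \<open>w\<close>.\<close>

lemma branch_koebe:
  assumes "\<omega> \<in> space M" "set w \<subseteq> \<G>"
  shows "koebe_pair (branch w \<omega>) (bderiv w \<omega>)"
  using assms
proof (induction w arbitrary: \<omega>)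
  case Nil
  then show ?case using koebe_pair_id by (simp add: koebe_pair_def)
next
  case (Cons D w)
  have "koebe_pair (branch w (\<theta> \<omega>)) (bderiv w (\<theta> \<omega>))"
    using Cons theta_space by auto
  moreover have "koebe_pair (inv_br D \<omega>) (\<lambda>x. 1 / \<bar>deriv_in D (T \<omega>) (inv_br D \<omega> x)\<bar>)"
    using Cons by (intro inv_br_koebe) auto
  ultimately have "koebe_pair (\<lambda>x. inv_br D \<omega> (branch w (\<theta> \<omega>) x)) (\<lambda>x. bderiv w (\<theta> \<omega>) x *
      (1 / \<bar>deriv_in D (T \<omega>) (inv_br D \<omega> (branch w (\<theta> \<omega>) x))\<bar>))"
    by (rule koebe_pair_compose)
  moreover have "branch (D # w) \<omega> = (\<lambda>x. inv_br D \<omega> (branch w (\<theta> \<omega>) x))"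
    "bderiv (D # w) \<omega> = (\<lambda>x. bderiv w (\<theta> \<omega>) x *
      (1 / \<bar>deriv_in D (T \<omega>) (inv_br D \<omega> (branch w (\<theta> \<omega>) x))\<bar>))"
    by auto
  ultimately show ?case by simp
qed

primrec trop_iter :: "real \<Rightarrow> nat \<Rightarrow> nat \<Rightarrow> 'w \<Rightarrow> (real \<Rightarrow> real) \<Rightarrow> real \<Rightarrow> real" where
  "trop_iter t k 0 \<omega> g = g"
| "trop_iter t k (Suc n) \<omega> g = trop_iter t k n (\<theta> \<omega>) (trop t k \<omega> g)"

text \<open>Forward invariance of the truncated sets lets one indicator at the final preimage
  replace the conditions at all intermediate ones.\<close>

lemma trop_iter_eq:
  assumes "\<omega> \<in> space M" "x \<in> Jul k ((\<theta> ^^ n) \<omega>)"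
  shows "trop_iter t k n \<omega> g x = (\<Sum>w\<in>words n. if branch w \<omega> x \<in> Jul k \<omega>
      then g (branch w \<omega> x) * bderiv w \<omega> x powr t else 0)"
  using assms
proof (induction n arbitrary: \<omega> g)
  case 0
  have "words 0 = {[]}" by (auto simp: words_def)
  with 0 show ?case by simp
next
  case (Suc n)
  note \<omega> = Suc.prems(1)
  note \<theta>\<omega> = theta_space[OF \<omega>]
  have x: "x \<in> Jul k ((\<theta> ^^ n) (\<theta> \<omega>))" using Suc.prems(2) by (simp add: funpow_swap1)
  have x01: "0 < x" "x < 1" using Jul_open_unit[OF theta_pow_space[OF \<theta>\<omega>] x] by auto
  let ?F = "\<lambda>D w. if branch (D # w) \<omega> x \<in> Jul k \<omega>
      then g (branch (D # w) \<omega> x) * bderiv (D # w) \<omega> x powr t else 0"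
  have *: "(if branch w (\<theta> \<omega>) x \<in> Jul k (\<theta> \<omega>)
        then trop t k \<omega> g (branch w (\<theta> \<omega>) x) * bderiv w (\<theta> \<omega>) x powr t else 0)
      = (\<Sum>D\<in>\<G>. ?F D w)" if w: "w \<in> words n" for w
  proof -
    have kw: "koebe_pair (branch w (\<theta> \<omega>)) (bderiv w (\<theta> \<omega>))"
      using branch_koebe[OF \<theta>\<omega>] w by (auto simp: words_def)
    note z = koebe_pair_interior[OF kw x01]
    note dpos = koebe_pair_pos[OF kw x01]
    show ?thesis
    proof (cases "branch w (\<theta> \<omega>) x \<in> Jul k (\<theta> \<omega>)")
      case True
      have **: "bderiv (D # w) \<omega> x powr t = bderiv w (\<theta> \<omega>) x powr t *
          \<bar>deriv_in D (T \<omega>) (inv_br D \<omega> (branch w (\<theta> \<omega>) x))\<bar> powr (- t)" if "D \<in> \<G>" for D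
        using dpos by (simp add: powr_mult powr_divide powr_minus_divide)
      show ?thesis
        unfolding trop_eq[OF \<omega> z] sum_distrib_right if_P[OF True]
      proof (rule sum.cong[OF refl])
        fix D assume D: "D \<in> \<G>"
        show "(if inv_br D \<omega> (branch w (\<theta> \<omega>) x) \<in> Jul k \<omega>
            then g (inv_br D \<omega> (branch w (\<theta> \<omega>) x)) *
              \<bar>deriv_in D (T \<omega>) (inv_br D \<omega> (branch w (\<theta> \<omega>) x))\<bar> powr - t
            else 0) * bderiv w (\<theta> \<omega>) x powr t = ?F D w"
          unfolding **[OF D] by (simp del: bderiv.simps)
      qed
    next
      case False
      then have "?F D w = 0" if "D \<in> \<G>" for D
        using inv_br_Jul_imp[OF \<omega> that, of "branch w (\<theta> \<omega>) x" k] z by auto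
      then show ?thesis using False by (simp del: branch.simps bderiv.simps)
    qed
  qed
  have "trop_iter t k (Suc n) \<omega> g x = (\<Sum>w\<in>words n. \<Sum>D\<in>\<G>. ?F D w)"
    using Suc.IH[OF \<theta>\<omega> x, of "trop t k \<omega> g"] * by (simp del: branch.simps bderiv.simps)
  also have "\<dots> = (\<Sum>D\<in>\<G>. \<Sum>w\<in>words n. ?F D w)" by (rule sum.swap)
  also have "\<dots> = (\<Sum>(D, w)\<in>\<G> \<times> words n. ?F D w)" by (rule sum.cartesian_product)
  also have "\<dots> = (\<Sum>w\<in>words (Suc n). if branch w \<omega> x \<in> Jul k \<omega>
      then g (branch w \<omega> x) * bderiv w \<omega> x powr t else 0)"
    unfolding words_Suc by (subst sum.reindex) (auto simp: inj_on_def intro!: sum.cong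
      simp del: branch.simps bderiv.simps)
  finally show ?case .
qed

section \<open>Admissible words\<close>

text \<open>After \<open>j\<close> steps the cut point reaches 1, which lies in no truncated set.
  Hence comparison with a cut point is a locally constant condition on \<open>Jul\<close>.\<close>

lemma cut_notin_Jul: "\<omega> \<in> space M \<Longrightarrow> cut j \<omega> \<notin> Jul k \<omega>"
proof (induction j arbitrary: \<omega>)
  case 0
  then show ?case using Jul_open_unit(2)[of \<omega> 1 k] by auto
next
  case (Suc j)
  note \<theta>\<omega> = theta_space[OF Suc.prems]
  have "T \<omega> (cut (Suc j) \<omega>) = cut j (\<theta> \<omega>)"
    using T_inv_br[OF Suc.prems D0(1), of "cut j (\<theta> \<omega>)"] cut_pos[OF \<theta>\<omega>, of j]
      cut_bounds(2)[OF \<theta>\<omega>, of j] by simp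
  then show ?case using Suc.IH[OF \<theta>\<omega>] Jul_iff[of "cut (Suc j) \<omega>" k \<omega>] by auto
qed

section \<open>Continuity of the transfer operators\<close>

lemma inv_br_continuous:
  assumes \<omega>: "\<omega> \<in> space M" and D: "D \<in> \<G>"
  shows "continuous_on {0..1} (inv_br D \<omega>)"
proof -
  have "compact D" using G_interval[OF D] by (metis compact_Icc)
  then have "continuous_on (T \<omega> ` D) (inv_br D \<omega>)"
    using T_cont[OF \<omega> D] inv_br_T[OF \<omega> D] by (intro continuous_on_inv) auto
  then show ?thesis using T_onto[OF \<omega> D] by simp
qed

lemma deriv_continuous:
  assumes \<omega>: "\<omega> \<in> space M" and D: "D \<in> \<G>"
  shows "continuous_on D (deriv_in D (T \<omega>))"
proof -
  have "\<forall>j<3. nderiv_in j D (T \<omega>) differentiable_on D"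
    using T_Ck[OF \<omega> D] unfolding Ck_on_def by blast
  then have "nderiv_in 1 D (T \<omega>) differentiable_on D" by simp
  then have "continuous_on D (nderiv_in 1 D (T \<omega>))" by (rule differentiable_imp_continuous_on)
  then show ?thesis by (simp add: nderiv_in_def)
qed

text \<open>This makes the indicator in \<open>trop_eq\<close> continuous on the fibre: only
  \<open>D0\<close> imposes a threshold, and since the threshold is not a point of
  \<open>Jul k (\<theta> \<omega>)\<close>, that set splits there into two relatively open
  pieces.\<close>

lemma inv_br_Jul_open:
  assumes \<omega>: "\<omega> \<in> space M" and D: "D \<in> \<G>" and k: "1 \<le> k"
  obtains U V where "open U" "open V" "U \<inter> V = {}" "Jul k (\<theta> \<omega>) \<subseteq> U \<union> V"
    "\<And>x. x \<in> Jul k (\<theta> \<omega>) \<Longrightarrow> inv_br D \<omega> x \<in> Jul k \<omega> \<longleftrightarrow> x \<in> U"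
proof (cases "D = D0")
  case False
  have "inv_br D \<omega> x \<in> Jul k \<omega> \<longleftrightarrow> x \<in> UNIV" if "x \<in> Jul k (\<theta> \<omega>)" for x
    using inv_br_Jul_iff[OF \<omega> D that] cut_le_inv_br[OF \<omega> D False _ _ k, of x]
      Jul_open_unit[OF theta_space[OF \<omega>] that] by auto
  then show ?thesis by (intro that[of UNIV "{}"]) auto
next
  case True
  obtain j where j: "k = Suc j" using k by (cases k) auto
  let ?c = "cut j (\<theta> \<omega>)"
  have *: "inv_br D \<omega> x \<in> Jul k \<omega> \<longleftrightarrow> x \<in> {?c<..}" if x: "x \<in> Jul k (\<theta> \<omega>)" for x
  proof -
    have "inv_br D \<omega> x \<in> Jul k \<omega> \<longleftrightarrow> ?c \<le> x"
      using inv_br_Jul_iff[OF \<omega> D x] cut_Suc_le_inv_br_D0[OF \<omega>, of x j] True j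
        Jul_open_unit[OF theta_space[OF \<omega>] x] by auto
    moreover have "x \<noteq> ?c" using cut_notin_Jul[OF theta_space[OF \<omega>], of j k] x by auto
    ultimately show ?thesis by auto
  qed
  have sub: "Jul k (\<theta> \<omega>) \<subseteq> {?c<..} \<union> {..<?c}"
  proof
    fix x assume "x \<in> Jul k (\<theta> \<omega>)"
    then have "x \<noteq> ?c" using cut_notin_Jul[OF theta_space[OF \<omega>], of j k] by blast
    then show "x \<in> {?c<..} \<union> {..<?c}" by auto
  qed
  show ?thesis by (rule that[OF _ _ _ sub *]) auto
qed

text \<open>The dual eigenvalue equation is tested against continuous functions, so iterating it
  requires that the operators preserve continuity.\<close>

lemma trop_continuous:
  assumes \<omega>: "\<omega> \<in> space M" and k: "1 \<le> k" and g: "continuous_on (Jul k \<omega>) g"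
  shows "continuous_on (Jul k (\<theta> \<omega>)) (trop t k \<omega> g)"
proof -
  let ?J = "Jul k (\<theta> \<omega>)"
  have unit: "?J \<subseteq> {0<..<1}" using Jul_open_unit[OF theta_space[OF \<omega>], of _ k] by auto
  define F where "F = (\<lambda>D x. if inv_br D \<omega> x \<in> Jul k \<omega>
      then g (inv_br D \<omega> x) * \<bar>deriv_in D (T \<omega>) (inv_br D \<omega> x)\<bar> powr (- t) else 0)"
  have "continuous_on ?J (F D)" if D: "D \<in> \<G>" for D
  proof -
    obtain U V where UV: "open U" "open V" "U \<inter> V = {}" "?J \<subseteq> U \<union> V"
      "\<And>x. x \<in> ?J \<Longrightarrow> inv_br D \<omega> x \<in> Jul k \<omega> \<longleftrightarrow> x \<in> U"
      by (rule inv_br_Jul_open[OF \<omega> D k]) blast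
    have inv: "continuous_on (?J \<inter> U) (inv_br D \<omega>)"
      using unit by (intro continuous_on_subset[OF inv_br_continuous[OF \<omega> D]]) auto
    \<comment> \<open>Positivity of the reciprocal rules out a zero derivative because
      \<open>1 / 0 = 0\<close>.\<close>
    have nz: "deriv_in D (T \<omega>) (inv_br D \<omega> x) \<noteq> 0" if "x \<in> ?J" for x
      using koebe_pair_pos[OF inv_br_koebe[OF \<omega> D], of x] that unit by auto
    have "continuous_on (?J \<inter> U) (\<lambda>x. g (inv_br D \<omega> x))"
      using UV by (intro continuous_on_compose2[OF g inv]) auto
    moreover have "continuous_on (?J \<inter> U) (\<lambda>x. deriv_in D (T \<omega>) (inv_br D \<omega> x))"
      using unit inv_br_in[OF \<omega> D]
      by (intro continuous_on_compose2[OF deriv_continuous[OF \<omega> D] inv]) force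
    ultimately have "continuous_on (?J \<inter> U)
        (\<lambda>x. g (inv_br D \<omega> x) * \<bar>deriv_in D (T \<omega>) (inv_br D \<omega> x)\<bar> powr (- t))"
      using nz by (intro continuous_intros) auto
    then have 1: "continuous_on (?J \<inter> U) (F D)"
      by (rule continuous_on_eq) (use UV in \<open>auto simp: F_def\<close>)
    have 2: "continuous_on (?J \<inter> V) (F D)"
      by (rule continuous_on_eq[of _ "\<lambda>_. 0"]) (use UV in \<open>auto simp: F_def\<close>)
    have J: "?J \<inter> U \<union> ?J \<inter> V = ?J" using UV by auto
    have "continuous_on (?J \<inter> U \<union> ?J \<inter> V) (F D)"
      by (rule continuous_on_Un_local_open[OF _ _ 1 2])
         (use UV in \<open>simp_all only: J openin_open_Int\<close>)
    then show ?thesis by (simp only: J)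
  qed
  then have "continuous_on ?J (\<lambda>x. \<Sum>D\<in>\<G>. F D x)" by (intro continuous_on_sum) auto
  then show ?thesis
    by (rule continuous_on_eq) (use trop_eq[OF \<omega>] unit in \<open>auto simp: F_def\<close>)
qed

section \<open>Partition sums over admissible words\<close>

lemma branch_snoc: "branch (w @ [D]) \<omega> x = branch w \<omega> (inv_br D ((\<theta> ^^ length w) \<omega>) x)"
  by (induction w arbitrary: \<omega>) (auto simp: funpow_swap1)

lemma bderiv_snoc:
  "bderiv (w @ [D]) \<omega> x = bderiv w \<omega> (inv_br D ((\<theta> ^^ length w) \<omega>) x) *
     (1 / \<bar>deriv_in D (T ((\<theta> ^^ length w) \<omega>)) (inv_br D ((\<theta> ^^ length w) \<omega>) x)\<bar>)"
  by (induction w arbitrary: \<omega>) (auto simp: funpow_swap1 branch_snoc)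

text \<open>
  Whether a word may be followed by \<open>x\<close> depends only on the number of consecutive symbols \<open>D0\<close>, and
  a point of \<open>D1\<close> starts with none. The second conjunct carries this through the induction.
\<close>

lemma branch_Jul_transfer:
  assumes "\<omega> \<in> space M" "set w \<subseteq> \<G>" and k: "1 \<le> k"
    and x: "0 < x" "x < 1" and "branch w \<omega> x \<in> Jul k \<omega>"
    and y: "y \<in> D1" and "y \<in> Jul k ((\<theta> ^^ length w) \<omega>)"
  shows "branch w \<omega> y \<in> Jul k \<omega> \<and>
    (\<forall>m\<ge>1. cut m \<omega> \<le> branch w \<omega> x \<longrightarrow> cut m \<omega> \<le> branch w \<omega> y)"
  using assms(1,2,6,8)
proof (induction w arbitrary: \<omega>)
  case Nil
  then show ?case
    using D0_le[OF D1(1) D0_neq_D1[symmetric] y cut_in_D0[OF Nil(1)]] by simp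
next
  case (Cons D w)
  note \<omega> = Cons.prems(1)
  note \<theta>\<omega> = theta_space[OF \<omega>]
  have D: "D \<in> \<G>" and w: "set w \<subseteq> \<G>" using Cons.prems(2) by auto
  have y': "y \<in> Jul k ((\<theta> ^^ length w) (\<theta> \<omega>))" using Cons.prems(4) by (simp add: funpow_swap1)
  have y01: "0 < y" "y < 1" using Jul_open_unit[OF theta_pow_space[OF \<theta>\<omega>] y'] by auto
  let ?x = "branch w (\<theta> \<omega>) x" and ?y = "branch w (\<theta> \<omega>) y"
  note kw = branch_koebe[OF \<theta>\<omega> w]
  have x01: "0 < ?x" "?x < 1" using koebe_pair_interior[OF kw x] by auto
  have y01': "0 < ?y" "?y < 1" using koebe_pair_interior[OF kw y01] by auto
  have xJ: "?x \<in> Jul k (\<theta> \<omega>)"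
    using inv_br_Jul_imp[OF \<omega> D, of ?x k] Cons.prems(3) x01 by simp
  note IH = Cons.IH[OF \<theta>\<omega> w xJ y']
  have cuts: "cut m \<omega> \<le> inv_br D \<omega> ?y" if m: "1 \<le> m" "cut m \<omega> \<le> inv_br D \<omega> ?x" for m
  proof (cases "D = D0")
    case False
    then show ?thesis using cut_le_inv_br[OF \<omega> D False, of ?y m] m y01' by simp
  next
    case True
    obtain j where j: "m = Suc j" using m(1) by (cases m) auto
    have le: "cut j (\<theta> \<omega>) \<le> ?x"
      using m(2) cut_Suc_le_inv_br_D0[OF \<omega>, of ?x j] x01 True j by auto
    \<comment> \<open>\<open>cut 0\<close> is 1, which the interior point \<open>?x\<close> cannot
      reach, so the induction hypothesis is never asked for level 0.\<close>
    have "j \<ge> 1" using le x01 by (cases j) auto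
    then have "cut j (\<theta> \<omega>) \<le> ?y" using IH le by blast
    then show ?thesis using cut_Suc_le_inv_br_D0[OF \<omega>, of ?y j] y01' True j by auto
  qed
  have "cut k \<omega> \<le> inv_br D \<omega> ?x" using Cons.prems(3) Jul_iff[of "inv_br D \<omega> ?x" k \<omega>] by simp
  then have "inv_br D \<omega> ?y \<in> Jul k \<omega>"
    using inv_br_Jul_iff[OF \<omega> D, of ?y k] IH cuts[OF k] by blast
  then show ?case using cuts by simp
qed

text \<open>Admissibility at some point of the fibre, rather than at a prescribed one, makes the
  sums \<open>psum\<close> independent of where the iterated operator is evaluated.\<close>

definition adm :: "nat \<Rightarrow> nat \<Rightarrow> 'w \<Rightarrow> real set list set" where
  "adm k n \<omega> = {w \<in> words n. \<exists>x\<in>Jul k ((\<theta> ^^ n) \<omega>). branch w \<omega> x \<in> Jul k \<omega>}"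

definition psum :: "real \<Rightarrow> nat \<Rightarrow> nat \<Rightarrow> 'w \<Rightarrow> real" where
  "psum t k n \<omega> = (\<Sum>w\<in>adm k n \<omega>. bderiv w \<omega> (1 / 2) powr t)"

lemma adm_words: "adm k n \<omega> \<subseteq> words n"
  by (auto simp: adm_def)

lemma finite_adm: "finite (adm k n \<omega>)"
  by (rule finite_subset[OF adm_words finite_words])

lemma bderiv_half:
  assumes "\<omega> \<in> space M" "w \<in> adm k n \<omega>"
  shows "0 < bderiv w \<omega> (1 / 2)" "bderiv w \<omega> (1 / 2) \<le> 1"
proof -
  have kw: "koebe_pair (branch w \<omega>) (bderiv w \<omega>)"
    using branch_koebe[OF assms(1)] subsetD[OF adm_words assms(2)] by (auto simp: words_def)
  show "0 < bderiv w \<omega> (1 / 2)" by (rule koebe_pair_pos[OF kw]) auto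
  show "bderiv w \<omega> (1 / 2) \<le> 1" by (rule koebe_half_le_1[OF kw])
qed

lemma trop_iter_le_psum:
  assumes \<omega>: "\<omega> \<in> space M" and x: "x \<in> Jul k ((\<theta> ^^ n) \<omega>)" and t: "0 \<le> t"
  shows "trop_iter t k n \<omega> (\<lambda>_. 1) x \<le> (A ^ (2 * Suc k)) powr t * psum t k n \<omega>"
proof -
  \<comment> \<open>The distance from \<open>{0, 1}\<close> provided by \<open>Jul_bounds\<close>;
    its inverse square, \<open>A ^ (2 * Suc k)\<close>, is the loss in
    \<open>koebe_le_half\<close>.\<close>
  define \<delta> where "\<delta> = (1 / A) ^ Suc k"
  have \<delta>: "0 < \<delta>" "\<delta> \<le> x" "x \<le> 1 - \<delta>"
    using A_gt_1 Jul_bounds[OF theta_pow_space[OF \<omega>] x] by (auto simp: \<delta>_def)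
  have x01: "0 < x" "x < 1" using \<delta> by auto
  have \<delta>2: "b / \<delta>\<^sup>2 = A ^ (2 * Suc k) * b" for b
    unfolding power_even_eq[of A] \<delta>_def by (simp add: power_one_over)
  have "trop_iter t k n \<omega> (\<lambda>_. 1) x
      = (\<Sum>w\<in>words n. if branch w \<omega> x \<in> Jul k \<omega> then bderiv w \<omega> x powr t else 0)"
    unfolding trop_iter_eq[OF \<omega> x] by (intro sum.cong) auto
  also have "\<dots> \<le> (\<Sum>w\<in>words n. if w \<in> adm k n \<omega>
      then (A ^ (2 * Suc k)) powr t * bderiv w \<omega> (1 / 2) powr t else 0)"
  proof (rule sum_mono)
    fix w assume w: "w \<in> words n"
    have kw: "koebe_pair (branch w \<omega>) (bderiv w \<omega>)"
      using branch_koebe[OF \<omega>] w by (auto simp: words_def)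
    have le: "bderiv w \<omega> x powr t \<le> (A ^ (2 * Suc k)) powr t * bderiv w \<omega> (1 / 2) powr t"
    proof -
      have "bderiv w \<omega> x powr t \<le> (A ^ (2 * Suc k) * bderiv w \<omega> (1 / 2)) powr t"
        using koebe_le_half[OF kw \<delta>] koebe_pair_pos[OF kw x01] t
        unfolding \<delta>2 by (intro powr_mono2) auto
      also have "\<dots> = (A ^ (2 * Suc k)) powr t * bderiv w \<omega> (1 / 2) powr t"
        using A_gt_1 koebe_pair_pos[OF kw, of "1 / 2"] by (intro powr_mult)
      finally show ?thesis .
    qed
    show "(if branch w \<omega> x \<in> Jul k \<omega> then bderiv w \<omega> x powr t else 0)
      \<le> (if w \<in> adm k n \<omega> then (A ^ (2 * Suc k)) powr t * bderiv w \<omega> (1 / 2) powr t else 0)"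
      using le w x by (auto simp: adm_def)
  qed
  also have "\<dots> = (\<Sum>w\<in>adm k n \<omega>. (A ^ (2 * Suc k)) powr t * bderiv w \<omega> (1 / 2) powr t)"
    using finite_words adm_words by (simp add: sum.If_cases Int_absorb1)
  finally show ?thesis by (simp add: psum_def sum_distrib_left)
qed

text \<open>A word in \<open>adm k n \<omega>\<close> need not be admissible at \<open>x\<close>,
  but it is admissible at the preimage \<open>y\<close> of \<open>x\<close> in \<open>D1\<close>, by
  \<open>branch_Jul_transfer\<close>. The detour costs one extra symbol and a factor
  \<open>1 / A\<close> for the derivative on \<open>D1\<close>; moving from the midpoint to
  \<open>y\<close> costs the factor \<open>1 / 4\<close>. Neither depends on
  \<open>k\<close>.\<close>

lemma psum_le_trop_iter:
  assumes \<omega>: "\<omega> \<in> space M" and k: "1 \<le> k"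
    and x: "x \<in> Jul k ((\<theta> ^^ Suc n) \<omega>)" and t: "0 \<le> t"
  shows "(1 / (4 * A)) powr t * psum t k n \<omega> \<le> trop_iter t k (Suc n) \<omega> (\<lambda>_. 1) x"
proof -
  let ?\<omega> = "(\<theta> ^^ n) \<omega>"
  note \<theta>\<omega> = theta_pow_space[OF \<omega>, of n]
  have x': "x \<in> Jul k (\<theta> ?\<omega>)" using x by simp
  have x01: "0 < x" "x < 1" using Jul_open_unit[OF theta_space[OF \<theta>\<omega>] x'] by auto
  define y where "y = inv_br D1 ?\<omega> x"
  have yJ: "y \<in> Jul k ?\<omega>"
    using inv_br_Jul_iff[OF \<theta>\<omega> D1(1) x'] cut_le_inv_br[OF \<theta>\<omega> D1(1) D0_neq_D1[symmetric] _ _ k] x01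
    by (simp add: y_def)
  have y01: "0 < y" "y < 1" using Jul_open_unit[OF \<theta>\<omega> yJ] by auto
  have yD: "y \<in> D1" using inv_br_in[OF \<theta>\<omega> D1(1)] x01 by (simp add: y_def)
  have Dpos: "0 < 1 / \<bar>deriv_in D1 (T ?\<omega>) y\<bar>"
    using koebe_pair_pos[OF inv_br_koebe[OF \<theta>\<omega> D1(1)] x01] by (simp add: y_def)
  have Dge: "1 / A \<le> 1 / \<bar>deriv_in D1 (T ?\<omega>) y\<bar>"
    using T_deriv_le[OF \<theta>\<omega> D1(1) yD] Dpos by (intro divide_left_mono) auto
  have words: "(\<lambda>w. w @ [D1]) ` adm k n \<omega> \<subseteq> words (Suc n)"
    using D1(1) adm_words by (force simp: words_def)
  have inj: "inj_on (\<lambda>w. w @ [D1]) (adm k n \<omega>)" by (auto simp: inj_on_def)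
  let ?F = "\<lambda>w. if branch w \<omega> x \<in> Jul k \<omega> then bderiv w \<omega> x powr t else 0"
  have "(1 / (4 * A)) powr t * psum t k n \<omega>
      = (\<Sum>w\<in>adm k n \<omega>. (1 / (4 * A)) powr t * bderiv w \<omega> (1 / 2) powr t)"
    by (simp add: psum_def sum_distrib_left)
  also have "\<dots> \<le> (\<Sum>w\<in>adm k n \<omega>. ?F (w @ [D1]))"
  proof (rule sum_mono)
    fix w assume w: "w \<in> adm k n \<omega>"
    have wG: "set w \<subseteq> \<G>" "length w = n" using subsetD[OF adm_words w] by (auto simp: words_def)
    obtain z where z: "z \<in> Jul k ?\<omega>" "branch w \<omega> z \<in> Jul k \<omega>" using w by (auto simp: adm_def)
    have z01: "0 < z" "z < 1" using Jul_open_unit[OF \<theta>\<omega> z(1)] by auto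
    have "branch w \<omega> y \<in> Jul k \<omega>"
      using branch_Jul_transfer[OF \<omega> wG(1) k z01 z(2) yD] yJ wG(2) by simp
    then have mem: "branch (w @ [D1]) \<omega> x \<in> Jul k \<omega>" by (simp add: branch_snoc wG(2) y_def)
    have kw: "koebe_pair (branch w \<omega>) (bderiv w \<omega>)" by (rule branch_koebe[OF \<omega> wG(1)])
    note dy = koebe_pair_pos[OF kw y01] and dh = bderiv_half(1)[OF \<omega> w]
    have "(1 / (4 * A)) * bderiv w \<omega> (1 / 2) = bderiv w \<omega> (1 / 2) / 4 * (1 / A)" by simp
    also have "\<dots> \<le> bderiv w \<omega> y * (1 / \<bar>deriv_in D1 (T ?\<omega>) y\<bar>)"
      using koebe_half_le[OF kw y01] Dge dy A_gt_1 by (intro mult_mono) auto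
    also have "\<dots> = bderiv (w @ [D1]) \<omega> x" by (simp add: bderiv_snoc wG(2) y_def)
    finally have "(1 / (4 * A) * bderiv w \<omega> (1 / 2)) powr t \<le> bderiv (w @ [D1]) \<omega> x powr t"
      using dh A_gt_1 t by (intro powr_mono2) auto
    also have "(1 / (4 * A) * bderiv w \<omega> (1 / 2)) powr t
        = (1 / (4 * A)) powr t * bderiv w \<omega> (1 / 2) powr t"
      by (rule powr_mult)
    finally show "(1 / (4 * A)) powr t * bderiv w \<omega> (1 / 2) powr t \<le> ?F (w @ [D1])"
      using mem by simp
  qed
  also have "\<dots> = (\<Sum>w\<in>(\<lambda>w. w @ [D1]) ` adm k n \<omega>. ?F w)"
    using inj by (simp add: sum.reindex)
  also have "\<dots> \<le> (\<Sum>w\<in>words (Suc n). ?F w)"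
    using words finite_words by (intro sum_mono2) auto
  also have "\<dots> = trop_iter t k (Suc n) \<omega> (\<lambda>_. 1) x"
    unfolding trop_iter_eq[OF \<omega> x] by (intro sum.cong) auto
  finally show ?thesis .
qed

lemma psum_nonneg: "0 \<le> psum t k n \<omega>"
  unfolding psum_def by (intro sum_nonneg) auto

lemma psum_antimono:
  assumes "\<omega> \<in> space M" "s \<le> t" shows "psum t k n \<omega> \<le> psum s k n \<omega>"
  unfolding psum_def
proof (rule sum_mono)
  fix w assume w: "w \<in> adm k n \<omega>"
  show "bderiv w \<omega> (1 / 2) powr t \<le> bderiv w \<omega> (1 / 2) powr s"
    using assms(2) bderiv_half[OF assms(1) w] by (intro powr_mono') auto
qed

lemma psum_0_le: "psum 0 k n \<omega> \<le> real (card \<G>) ^ n"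
proof -
  have "psum 0 k n \<omega> \<le> (\<Sum>w\<in>adm k n \<omega>. 1)"
    unfolding psum_def by (intro sum_mono) simp
  also have "\<dots> = real (card (adm k n \<omega>))" by simp
  also have "\<dots> \<le> real (card (words n))"
    using card_mono[OF finite_words adm_words] by simp
  finally show ?thesis by (simp add: card_words)
qed

lemma psum_Suc_le:
  assumes \<omega>: "\<omega> \<in> space M" shows "psum t k n \<omega> \<le> psum t (Suc k) n \<omega>"
proof -
  have "adm k n \<omega> \<subseteq> adm (Suc k) n \<omega>"
    using Jul_Suc_subset[OF \<omega>, of k] Jul_Suc_subset[OF theta_pow_space[OF \<omega>], of k n]
    unfolding adm_def by blast
  then show ?thesis unfolding psum_def using finite_adm by (intro sum_mono2) auto
qed

lemma psum_0_eq_1: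
  assumes "Jul k \<omega> \<noteq> {}" shows "psum t k 0 \<omega> = 1"
proof -
  obtain x where "x \<in> Jul k \<omega>" using assms by blast
  then have "\<exists>x\<in>Jul k ((\<theta> ^^ 0) \<omega>). branch [] \<omega> x \<in> Jul k \<omega>" by (intro bexI[of _ x]) simp_all
  moreover have "words 0 = {[]}" by (auto simp: words_def)
  ultimately have "adm k 0 \<omega> = {[]}" unfolding adm_def by blast
  then show ?thesis by (simp add: psum_def)
qed

text \<open>The bound is required along the forward orbit of \<open>\<omega>\<close> only, since the
  essential supremum will supply it for almost every \<open>\<omega>\<close>, not for all.\<close>

lemma bderiv_ge:
  assumes "\<omega> \<in> space M" "set w \<subseteq> \<G>" and x: "0 < x" "x < 1" and B: "0 < B"
    and "\<And>i D y. D \<in> \<G> \<Longrightarrow> y \<in> D \<Longrightarrow> \<bar>deriv_in D (T ((\<theta> ^^ i) \<omega>)) y\<bar> \<le> B"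
  shows "(1 / B) ^ length w \<le> bderiv w \<omega> x"
  using assms(1,2,6)
proof (induction w arbitrary: \<omega>)
  case (Cons D w)
  note \<omega> = Cons.prems(1)
  note \<theta>\<omega> = theta_space[OF \<omega>]
  have D: "D \<in> \<G>" and w: "set w \<subseteq> \<G>" using Cons.prems(2) by auto
  have B': "\<bar>deriv_in D (T ((\<theta> ^^ i) (\<theta> \<omega>))) y\<bar> \<le> B" if "D \<in> \<G>" "y \<in> D" for i D y
    using Cons.prems(3)[OF that, of "Suc i"] by (simp add: funpow_swap1)
  note IH = Cons.IH[OF \<theta>\<omega> w B']
  let ?y = "branch w (\<theta> \<omega>) x"
  note y = koebe_pair_interior[OF branch_koebe[OF \<theta>\<omega> w] x]
  have pos: "0 < 1 / \<bar>deriv_in D (T \<omega>) (inv_br D \<omega> ?y)\<bar>"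
    using koebe_pair_pos[OF inv_br_koebe[OF \<omega> D] y] .
  have "\<bar>deriv_in D (T \<omega>) (inv_br D \<omega> ?y)\<bar> \<le> B"
    using Cons.prems(3)[OF D, of _ 0] inv_br_in[OF \<omega> D] y by simp
  then have "1 / B \<le> 1 / \<bar>deriv_in D (T \<omega>) (inv_br D \<omega> ?y)\<bar>"
    using pos B by (intro divide_left_mono) auto
  moreover have "0 < (1 / B) ^ length w" using B by simp
  ultimately have "(1 / B) ^ length w * (1 / B) \<le> bderiv w (\<theta> \<omega>) x *
      (1 / \<bar>deriv_in D (T \<omega>) (inv_br D \<omega> ?y)\<bar>)"
    using IH B koebe_pair_pos[OF branch_koebe[OF \<theta>\<omega> w] x] by (intro mult_mono) auto
  then show ?case by (simp add: mult_ac)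
qed simp

lemma psum_lipschitz:
  assumes \<omega>: "\<omega> \<in> space M" and B: "0 < B" and st: "s \<le> t"
    and bound: "\<And>i D y. D \<in> \<G> \<Longrightarrow> y \<in> D \<Longrightarrow> \<bar>deriv_in D (T ((\<theta> ^^ i) \<omega>)) y\<bar> \<le> B"
  shows "psum s k n \<omega> \<le> (B powr (t - s)) ^ n * psum t k n \<omega>"
proof -
  have "bderiv w \<omega> (1 / 2) powr s \<le> (B powr (t - s)) ^ n * bderiv w \<omega> (1 / 2) powr t"
    if w: "w \<in> adm k n \<omega>" for w
  proof -
    let ?b = "bderiv w \<omega> (1 / 2)"
    have wG: "set w \<subseteq> \<G>" "length w = n" using subsetD[OF adm_words w] by (auto simp: words_def)
    have b: "(1 / B) ^ n \<le> ?b"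
      using bderiv_ge[OF \<omega> wG(1) _ _ B bound, of "1 / 2"] wG(2) by simp
    note bpos = bderiv_half(1)[OF \<omega> w]
    have "1 / B ^ n \<le> ?b" using b by (simp add: power_one_over)
    then have "1 \<le> B ^ n * ?b" using B by (simp add: field_simps)
    \<comment> \<open>This power is exactly the discrepancy between the exponents \<open>s\<close>
      and \<open>t\<close> in the term of \<open>w\<close>.\<close>
    then have "1 \<le> (B ^ n * ?b) powr (t - s)" using st by (intro ge_one_powr_ge_zero) auto
    also have "\<dots> = (B powr (t - s)) ^ n * ?b powr (t - s)"
      using B by (simp add: powr_mult powr_power powr_powr mult.commute flip: powr_realpow)
    finally have "1 * ?b powr s \<le> (B powr (t - s)) ^ n * ?b powr (t - s) * ?b powr s"
      by (intro mult_right_mono) auto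
    then show ?thesis by (simp add: mult.assoc flip: powr_add)
  qed
  then show ?thesis unfolding psum_def sum_distrib_left by (rule sum_mono)
qed

end

section \<open>Comparison of expected pressures\<close>

text \<open>Integrability of \<open>F\<close> is not assumed: failing it, the integral is 0 and
  \<open>0 \<le> C\<close> decides. Likewise \<open>S\<close> is measurable, since a nonmeasurable
  set has measure 0 by default.\<close>

lemma (in prob_space) set_integral_le_const:
  fixes F :: "'a \<Rightarrow> real"
  assumes "prob S = 1" "0 \<le> C" and le: "\<And>x. x \<in> S \<Longrightarrow> F x \<le> C"
  shows "(LINT x:S|M. F x) \<le> C"
proof (cases "set_integrable M S F")
  case True
  have S: "S \<in> events" using assms(1) measure_notin_sets by fastforce
  have "set_integrable M S (\<lambda>_. C)"
    unfolding set_integrable_def using S by (intro integrable_mult_indicator) auto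
  then have "(LINT x:S|M. F x) \<le> (LINT x:S|M. C)"
    using True le by (intro set_integral_mono)
  also have "\<dots> = C" using S assms(1) by (simp add: set_integral_const)
  finally show ?thesis .
next
  case False
  then have "(LINT x:S|M. F x) = 0"
    unfolding set_integrable_def set_lebesgue_integral_def by (rule not_integrable_integral_eq)
  with assms(2) show ?thesis by simp
qed

text \<open>A nonzero integral certifies integrability. In the application the integral is a product
  of positive eigenvalues.\<close>

lemma (in prob_space) set_integral_ge_const:
  fixes F :: "'a \<Rightarrow> real"
  assumes "prob S = 1" "(LINT x:S|M. F x) \<noteq> 0" and ge: "\<And>x. x \<in> S \<Longrightarrow> C \<le> F x"
  shows "C \<le> (LINT x:S|M. F x)"
proof -
  have S: "S \<in> events" using assms(1) measure_notin_sets by fastforce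
  have F: "set_integrable M S F"
    using assms(2) not_integrable_integral_eq unfolding set_integrable_def set_lebesgue_integral_def by blast
  have "set_integrable M S (\<lambda>_. C)"
    unfolding set_integrable_def using S by (intro integrable_mult_indicator) auto
  then have "(LINT x:S|M. C) \<le> (LINT x:S|M. F x)"
    using F ge by (intro set_integral_mono)
  then show ?thesis using S assms(1) by (simp add: set_integral_const)
qed

section \<open>Eigenvalue products along orbits\<close>

context random_critically_finite_map
begin

lemma AE_theta_pow:
  assumes "AE \<omega> in M. P \<omega>" shows "AE \<omega> in M. \<forall>n. P ((\<theta> ^^ n) \<omega>)"
  unfolding AE_all_countable
proof
  fix n show "AE \<omega> in M. P ((\<theta> ^^ n) \<omega>)"
  proof (induction n)
    case (Suc n)
    have "AE \<omega> in distr M M \<theta>. P ((\<theta> ^^ n) \<omega>)" using Suc by (simp only: theta_preserving)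
    from AE_distrD[OF theta_measurable this] show ?case by (simp add: funpow_swap1)
  qed (use assms in simp)
qed

lemma has_integral_theta_pow:
  fixes f :: "'w \<Rightarrow> real"
  assumes "integrable M f"
  shows "integrable M (\<lambda>\<omega>. f ((\<theta> ^^ n) \<omega>)) \<and> (\<integral>\<omega>. f ((\<theta> ^^ n) \<omega>) \<partial>M) = (\<integral>\<omega>. f \<omega> \<partial>M)"
proof (induction n)
  case (Suc n)
  let ?g = "\<lambda>\<omega>. f ((\<theta> ^^ n) \<omega>)"
  have g: "integrable (distr M M \<theta>) ?g" using Suc by (simp add: theta_preserving)
  have "integrable M (\<lambda>\<omega>. ?g (\<theta> \<omega>))" using integrable_distr[OF theta_measurable g] .
  moreover have "(\<integral>\<omega>. ?g (\<theta> \<omega>) \<partial>M) = (\<integral>\<omega>. ?g \<omega> \<partial>distr M M \<theta>)"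
    using Suc by (intro integral_distr[symmetric] theta_measurable) auto
  ultimately show ?case using Suc by (simp add: funpow_swap1 theta_preserving)
qed (use assms in simp)

text \<open>The almost sure clauses of \<open>random_eigenmeasure\<close> at a single base point, so
  that they can be demanded along a whole orbit.\<close>

definition eigen_at :: "real \<Rightarrow> nat \<Rightarrow> ('w \<Rightarrow> real measure) \<Rightarrow> ('w \<Rightarrow> real) \<Rightarrow> 'w \<Rightarrow> bool" where
  "eigen_at t k \<nu> \<Lambda> \<omega> \<longleftrightarrow> measure (\<nu> \<omega>) (Jul k \<omega>) = 1 \<and>
     (\<forall>g. continuous_on (Jul k \<omega>) g \<longrightarrow>
        (LINT x:Jul k (\<theta> \<omega>)|\<nu> (\<theta> \<omega>). trop t k \<omega> g x) = \<Lambda> \<omega> * (LINT x:Jul k \<omega>|\<nu> \<omega>. g x))"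

lemma trop_iter_integral:
  assumes "\<omega> \<in> space M" and k: "1 \<le> k"
    and "\<forall>n. eigen_at t k \<nu> \<Lambda> ((\<theta> ^^ n) \<omega>)" and "continuous_on (Jul k \<omega>) g"
  shows "(LINT x:Jul k ((\<theta> ^^ n) \<omega>)|\<nu> ((\<theta> ^^ n) \<omega>). trop_iter t k n \<omega> g x)
    = (\<Prod>i<n. \<Lambda> ((\<theta> ^^ i) \<omega>)) * (LINT x:Jul k \<omega>|\<nu> \<omega>. g x)"
  using assms(1,3,4)
proof (induction n arbitrary: \<omega> g)
  case (Suc n)
  have swap: "(\<theta> ^^ m) (\<theta> \<omega>) = (\<theta> ^^ Suc m) \<omega>" for m by (simp add: funpow_swap1)
  have "\<forall>n. eigen_at t k \<nu> \<Lambda> ((\<theta> ^^ n) (\<theta> \<omega>))" unfolding swap using Suc.prems(2) by blast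
  note IH = Suc.IH[OF theta_space[OF Suc.prems(1)] this trop_continuous[OF Suc.prems(1) k Suc.prems(3)], of t]
  have "eigen_at t k \<nu> \<Lambda> \<omega>" using Suc.prems(2)[rule_format, of 0] by simp
  then have "(LINT x:Jul k (\<theta> \<omega>)|\<nu> (\<theta> \<omega>). trop t k \<omega> g x) = \<Lambda> \<omega> * (LINT x:Jul k \<omega>|\<nu> \<omega>. g x)"
    using Suc.prems(3) unfolding eigen_at_def by blast
  with IH show ?case
    unfolding swap trop_iter.simps(2) prod.lessThan_Suc_shift by (simp del: funpow.simps(2))
qed simp

context
  fixes t :: real and k :: nat and \<nu> :: "'w \<Rightarrow> real measure" and \<Lambda> :: "'w \<Rightarrow> real"
  assumes t0: "0 \<le> t" and k1: "1 \<le> k"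
    and eigen: "random_eigenmeasure M \<theta> T \<G> D0 t k \<nu> \<Lambda>"
begin

lemma
  shows eigen_nu: "\<nu> \<in> measurable M (prob_algebra borel)"
    and eigen_support: "AE \<omega> in M. measure (\<nu> \<omega>) (Jul k \<omega>) = 1"
    and eigen_meas: "\<Lambda> \<in> borel_measurable M"
    and eigen_pos_all: "\<forall>\<omega>\<in>space M. \<Lambda> \<omega> > 0"
    and eigen_eq: "AE \<omega> in M. \<forall>g. continuous_on (Jul k \<omega>) g \<longrightarrow>
        (LINT x:Jul k (\<theta> \<omega>)|\<nu> (\<theta> \<omega>). trop t k \<omega> g x) = \<Lambda> \<omega> * (LINT x:Jul k \<omega>|\<nu> \<omega>. g x)"
  using eigen unfolding random_eigenmeasure_def by - (elim conjE, assumption)+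

lemma eigen_pos: "\<omega> \<in> space M \<Longrightarrow> 0 < \<Lambda> \<omega>"
  using eigen_pos_all by blast

lemma eigen_prob_space: "\<omega> \<in> space M \<Longrightarrow> prob_space (\<nu> \<omega>)"
  using measurable_space[OF eigen_nu] by (simp add: space_prob_algebra)

lemma eigen_AE: "AE \<omega> in M. \<forall>n. eigen_at t k \<nu> \<Lambda> ((\<theta> ^^ n) \<omega>)"
proof (rule AE_theta_pow)
  show "AE \<omega> in M. eigen_at t k \<nu> \<Lambda> \<omega>"
    using eigen_support eigen_eq unfolding eigen_at_def by eventually_elim simp
qed

lemma eigen_prod_eq:
  assumes \<omega>: "\<omega> \<in> space M" and E: "\<forall>n. eigen_at t k \<nu> \<Lambda> ((\<theta> ^^ n) \<omega>)"
  shows "(LINT x:Jul k ((\<theta> ^^ n) \<omega>)|\<nu> ((\<theta> ^^ n) \<omega>). trop_iter t k n \<omega> (\<lambda>_. 1) x)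
    = (\<Prod>i<n. \<Lambda> ((\<theta> ^^ i) \<omega>))"
proof -
  interpret N: prob_space "\<nu> \<omega>" by (rule eigen_prob_space[OF \<omega>])
  have one: "measure (\<nu> \<omega>) (Jul k \<omega>) = 1"
    using E[rule_format, of 0] by (simp add: eigen_at_def)
  then have "Jul k \<omega> \<in> sets (\<nu> \<omega>)" using measure_notin_sets by fastforce
  with one have "(LINT x:Jul k \<omega>|\<nu> \<omega>. (1::real)) = 1" by (simp add: set_integral_const)
  with trop_iter_integral[OF \<omega> k1 E, of "\<lambda>_. 1" n] show ?thesis by simp
qed

lemma eigen_prod_le:
  assumes \<omega>: "\<omega> \<in> space M" and E: "\<forall>n. eigen_at t k \<nu> \<Lambda> ((\<theta> ^^ n) \<omega>)"
  shows "(\<Prod>i<n. \<Lambda> ((\<theta> ^^ i) \<omega>)) \<le> (A ^ (2 * Suc k)) powr t * psum t k n \<omega>"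
  unfolding eigen_prod_eq[OF \<omega> E, symmetric]
proof (rule prob_space.set_integral_le_const)
  show "prob_space (\<nu> ((\<theta> ^^ n) \<omega>))" by (rule eigen_prob_space[OF theta_pow_space[OF \<omega>]])
  show "measure (\<nu> ((\<theta> ^^ n) \<omega>)) (Jul k ((\<theta> ^^ n) \<omega>)) = 1"
    using E unfolding eigen_at_def by blast
  show "0 \<le> (A ^ (2 * Suc k)) powr t * psum t k n \<omega>" using psum_nonneg by simp
qed (rule trop_iter_le_psum[OF \<omega> _ t0])

lemma eigen_prod_ge:
  assumes \<omega>: "\<omega> \<in> space M" and E: "\<forall>n. eigen_at t k \<nu> \<Lambda> ((\<theta> ^^ n) \<omega>)"
  shows "(1 / (4 * A)) powr t * psum t k n \<omega> \<le> (\<Prod>i<Suc n. \<Lambda> ((\<theta> ^^ i) \<omega>))"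
  unfolding eigen_prod_eq[OF \<omega> E, symmetric]
proof (rule prob_space.set_integral_ge_const)
  show "prob_space (\<nu> ((\<theta> ^^ Suc n) \<omega>))" by (rule eigen_prob_space[OF theta_pow_space[OF \<omega>]])
  show "measure (\<nu> ((\<theta> ^^ Suc n) \<omega>)) (Jul k ((\<theta> ^^ Suc n) \<omega>)) = 1"
    using E unfolding eigen_at_def by blast
  have "0 < (\<Prod>i<Suc n. \<Lambda> ((\<theta> ^^ i) \<omega>))"
    using eigen_pos theta_pow_space[OF \<omega>] by (intro prod_pos) auto
  then show "(LINT x:Jul k ((\<theta> ^^ Suc n) \<omega>)|\<nu> ((\<theta> ^^ Suc n) \<omega>). trop_iter t k (Suc n) \<omega> (\<lambda>_. 1) x) \<noteq> 0"
    unfolding eigen_prod_eq[OF \<omega> E] by (rule less_imp_neq[THEN not_sym])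
qed (rule psum_le_trop_iter[OF \<omega> k1 _ t0])

text \<open>Both bounds are the estimates for a product of one factor: the upper one at word length
  1, the lower one at word length 0, where the partition sum is 1 since a set of full measure is
  nonempty.\<close>

lemma eigen_bounds:
  "AE \<omega> in M. (1 / (4 * A)) powr t \<le> \<Lambda> \<omega> \<and> \<Lambda> \<omega> \<le> (A ^ (2 * Suc k)) powr t * real (card \<G>)"
  using eigen_AE AE_space
proof eventually_elim
  case (elim \<omega>)
  then have \<omega>: "\<omega> \<in> space M" by blast
  have one: "measure (\<nu> \<omega>) (Jul k \<omega>) = 1"
    using elim(1)[rule_format, of 0] by (simp add: eigen_at_def)
  then have "Jul k \<omega> \<noteq> {}" by auto
  then have "(1 / (4 * A)) powr t \<le> \<Lambda> \<omega>"
    using eigen_prod_ge[OF \<omega> elim(1), of 0] by (simp add: psum_0_eq_1)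
  moreover have "\<Lambda> \<omega> \<le> (A ^ (2 * Suc k)) powr t * real (card \<G>)"
  proof -
    have "\<Lambda> \<omega> \<le> (A ^ (2 * Suc k)) powr t * psum t k 1 \<omega>"
      using eigen_prod_le[OF \<omega> elim(1), of 1] by simp
    also have "\<dots> \<le> (A ^ (2 * Suc k)) powr t * real (card \<G>)"
      using psum_antimono[OF \<omega> t0, of k 1] psum_0_le[of k 1 \<omega>] by (intro mult_left_mono) auto
    finally show ?thesis .
  qed
  ultimately show ?case ..
qed

text \<open>The Bochner integral of a nonintegrable function is 0, so this is needed for any comparison.\<close>

lemma ln_eigen_integrable: "integrable M (\<lambda>\<omega>. ln (\<Lambda> \<omega>))"
proof (rule integrable_const_bound)
  let ?a = "(1 / (4 * A)) powr t" and ?b = "(A ^ (2 * Suc k)) powr t * real (card \<G>)"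
  have a: "0 < ?a" using A_gt_1 by simp
  show "AE \<omega> in M. norm (ln (\<Lambda> \<omega>)) \<le> \<bar>ln ?a\<bar> + \<bar>ln ?b\<bar>"
    using eigen_bounds
  proof eventually_elim
    case (elim \<omega>)
    then have pos: "0 < \<Lambda> \<omega>" "0 < ?b" using a by linarith+
    have "ln ?a \<le> ln (\<Lambda> \<omega>)" "ln (\<Lambda> \<omega>) \<le> ln ?b"
      using elim unfolding ln_le_cancel_iff[OF a pos(1)] ln_le_cancel_iff[OF pos] by blast+
    then show ?case unfolding real_norm_def by linarith
  qed
  show "(\<lambda>\<omega>. ln (\<Lambda> \<omega>)) \<in> borel_measurable M" using eigen_meas by simp
qed

end

text \<open>At \<open>t = 0\<close> the distortion constant is raised to the power 0, so the bound
  is uniform in \<open>k\<close>, unlike the one in \<open>eigen_bounds\<close> for positive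
  \<open>t\<close>.\<close>

lemma expected_ln_le_card:
  assumes "1 \<le> k" "random_eigenmeasure M \<theta> T \<G> D0 0 k \<nu> \<Lambda>"
  shows "(\<integral>\<omega>. ln (\<Lambda> \<omega>) \<partial>M) \<le> ln (real (card \<G>))"
proof (rule integral_le_const)
  show "integrable M (\<lambda>\<omega>. ln (\<Lambda> \<omega>))" by (rule ln_eigen_integrable[OF _ assms]) simp
  show "AE \<omega> in M. ln (\<Lambda> \<omega>) \<le> ln (real (card \<G>))"
    using eigen_bounds[OF order_refl assms] AE_space
  proof eventually_elim
    case (elim \<omega>)
    have pos: "0 < \<Lambda> \<omega>" using eigen_pos[OF order_refl assms] elim(2) .
    moreover have "\<Lambda> \<omega> \<le> real (card \<G>)" using elim(1) A_gt_1 by simp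
    ultimately show ?case by simp
  qed
qed

text \<open>The common mechanism behind monotonicity in \<open>t\<close>, monotonicity in
  \<open>k\<close> and the Lipschitz bound: a comparison of partition sums with rate
  \<open>q\<close> becomes, through the eigenvalue products, a comparison of sums of logarithms
  along orbits. Invariance of the measure makes every summand integrate to the same number, and
  errors bounded in \<open>n\<close> disappear.\<close>

lemma expected_ln_le:
  assumes t: "0 \<le> t" "1 \<le> k" and e: "random_eigenmeasure M \<theta> T \<G> D0 t k \<nu> \<Lambda>"
    and s: "0 \<le> s" "1 \<le> l" and e': "random_eigenmeasure M \<theta> T \<G> D0 s l \<nu>' \<Lambda>'"
    and q: "0 < q" and le: "AE \<omega> in M. \<forall>n. psum t k n \<omega> \<le> q ^ n * psum s l n \<omega>"
  shows "(\<integral>\<omega>. ln (\<Lambda> \<omega>) \<partial>M) \<le> (\<integral>\<omega>. ln (\<Lambda>' \<omega>) \<partial>M) + ln q"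
proof -
  \<comment> \<open>The upper distortion loss for \<open>(t, k)\<close> over the lower one for
    \<open>(s, l)\<close>; it does not depend on \<open>n\<close>.\<close>
  define C where "C = (A ^ (2 * Suc k)) powr t / (1 / (4 * A)) powr s"
  have C: "0 < C" using A_gt_1 by (simp add: C_def)
  let ?I = "\<integral>\<omega>. ln (\<Lambda> \<omega>) \<partial>M" and ?I' = "\<integral>\<omega>. ln (\<Lambda>' \<omega>) \<partial>M"
  note int = has_integral_theta_pow[OF ln_eigen_integrable[OF t e]]
  note int' = has_integral_theta_pow[OF ln_eigen_integrable[OF s e']]
  have main: "real n * ?I \<le> (ln C + real n * ln q) + real (Suc n) * ?I'" for n
  proof -
    have "AE \<omega> in M. (\<Sum>i<n. ln (\<Lambda> ((\<theta> ^^ i) \<omega>)))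
        \<le> (ln C + real n * ln q) + (\<Sum>i<Suc n. ln (\<Lambda>' ((\<theta> ^^ i) \<omega>)))"
      using le eigen_AE[OF t e] eigen_AE[OF s e'] AE_space
    proof eventually_elim
      case (elim \<omega>)
      note \<omega> = elim(4)
      have pos: "0 < \<Lambda> ((\<theta> ^^ i) \<omega>)" "0 < \<Lambda>' ((\<theta> ^^ i) \<omega>)" for i
        using eigen_pos[OF t e] eigen_pos[OF s e'] theta_pow_space[OF \<omega>] by auto
      let ?P = "\<Prod>i<n. \<Lambda> ((\<theta> ^^ i) \<omega>)" and ?P' = "\<Prod>i<Suc n. \<Lambda>' ((\<theta> ^^ i) \<omega>)"
      have P: "0 < ?P" "0 < ?P'" using pos by (auto intro!: prod_pos simp del: prod.lessThan_Suc)
      have ln_prod3: "ln (C * q ^ n * X) = ln C + real n * ln q + ln X" if "0 < X" for X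
        using C q that by (simp add: ln_mult ln_realpow)
      have "?P \<le> (A ^ (2 * Suc k)) powr t * psum t k n \<omega>"
        by (rule eigen_prod_le[OF t e \<omega> elim(2)])
      also have "\<dots> \<le> (A ^ (2 * Suc k)) powr t * (q ^ n * psum s l n \<omega>)"
        using elim(1) by (intro mult_left_mono) auto
      also have "\<dots> = C * q ^ n * ((1 / (4 * A)) powr s * psum s l n \<omega>)"
        using A_gt_1 by (simp add: C_def)
      also have "\<dots> \<le> C * q ^ n * ?P'"
        using C q eigen_prod_ge[OF s e' \<omega> elim(3), of n] by (intro mult_left_mono) auto
      finally have "ln ?P \<le> ln (C * q ^ n * ?P')" using P by (intro ln_mono)
      also have "\<dots> = ln C + real n * ln q + ln ?P'"
        by (rule ln_prod3[OF P(2)])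
      also have "ln ?P' = (\<Sum>i<Suc n. ln (\<Lambda>' ((\<theta> ^^ i) \<omega>)))" by (intro ln_prod finite_lessThan) (metis pos less_irrefl)
      also have "ln ?P = (\<Sum>i<n. ln (\<Lambda> ((\<theta> ^^ i) \<omega>)))" by (intro ln_prod finite_lessThan) (metis pos less_irrefl)
      finally show ?case .
    qed
    then have "(\<integral>\<omega>. (\<Sum>i<n. ln (\<Lambda> ((\<theta> ^^ i) \<omega>))) \<partial>M)
        \<le> (\<integral>\<omega>. (ln C + real n * ln q) + (\<Sum>i<Suc n. ln (\<Lambda>' ((\<theta> ^^ i) \<omega>))) \<partial>M)"
      using int int' by (intro integral_mono_AE Bochner_Integration.integrable_sum
        Bochner_Integration.integrable_add) auto
    also have "\<dots> = (ln C + real n * ln q) + (\<integral>\<omega>. (\<Sum>i<Suc n. ln (\<Lambda>' ((\<theta> ^^ i) \<omega>))) \<partial>M)"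
      using int' by (subst Bochner_Integration.integral_add)
        (auto intro!: Bochner_Integration.integrable_sum simp: prob_space simp del: sum.lessThan_Suc)
    also have "(\<integral>\<omega>. (\<Sum>i<Suc n. ln (\<Lambda>' ((\<theta> ^^ i) \<omega>))) \<partial>M) = real (Suc n) * ?I'"
      using int' by (subst Bochner_Integration.integral_sum) (auto simp del: sum.lessThan_Suc)
    also have "(\<integral>\<omega>. (\<Sum>i<n. ln (\<Lambda> ((\<theta> ^^ i) \<omega>))) \<partial>M) = real n * ?I"
      using int by (subst Bochner_Integration.integral_sum) auto
    finally show ?thesis .
  qed
  \<comment> \<open>The surplus \<open>?I'\<close> stems from the additional factor in
    \<open>eigen_prod_ge\<close>; like \<open>ln C\<close> it is constant in
    \<open>n\<close>.\<close>
  have *: "real n * (?I - ?I' - ln q) \<le> ln C + ?I'" for n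
    using main[of n] by (simp add: algebra_simps)
  show ?thesis
  proof (rule ccontr)
    assume "\<not> ?thesis"
    then have "0 < ?I - ?I' - ln q" by simp
    then obtain n where "ln C + ?I' < real n * (?I - ?I' - ln q)"
      using reals_Archimedean3 by blast
    with *[of n] show False by simp
  qed
qed

text \<open>
  Measurability of the fibrewise sup norm is essential: the essential supremum of a nonmeasurable
  function is the top element, which \<open>deriv_sup_norm\<close> would turn into 0.
\<close>

lemma deriv_measurable:
  assumes D: "D \<in> \<G>" "D = {a..b}" and x: "a < x" "x < b"
  shows "(\<lambda>\<omega>. deriv_in D (T \<omega>) x) \<in> borel_measurable M"
proof -
  \<comment> \<open>Increments that tend to 0 without vanishing and keep \<open>x + h n\<close>
    inside \<open>D\<close> already for \<open>n = 0\<close>.\<close>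
  define h where "h n = (b - x) / real (Suc n)" for n
  have h: "0 < h n" "x + h n \<in> D" for n
  proof -
    show "0 < h n" using x by (simp add: h_def)
    have "h n \<le> (b - x) / 1" unfolding h_def using x by (intro divide_left_mono) auto
    then show "x + h n \<in> D" using D(2) x \<open>0 < h n\<close> by auto
  qed
  have xD: "x \<in> D" using D(2) x by auto
  have lim0: "h \<longlonglongrightarrow> 0" unfolding h_def by (rule LIMSEQ_Suc[OF lim_const_over_n])
  show ?thesis
  proof (rule borel_measurable_LIMSEQ_real)
    show "(\<lambda>\<omega>. (T \<omega> (x + h n) - T \<omega> x) / h n) \<in> borel_measurable M" for n
    proof -
      have "(\<lambda>\<omega>. T \<omega> x) \<in> borel_measurable M" "(\<lambda>\<omega>. T \<omega> (x + h n)) \<in> borel_measurable M"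
        using D(1) xD h(2)[of n] by (blast intro!: T_measurable)+
      then show ?thesis by measurable
    qed
    fix \<omega> assume \<omega>: "\<omega> \<in> space M"
    have "(T \<omega> has_real_derivative deriv_in D (T \<omega>) x) (at x)"
      using T_has_deriv[OF \<omega> D(1) xD] at_within_Icc_at[OF x] D(2) by simp
    then have "((\<lambda>\<epsilon>. (T \<omega> (x + \<epsilon>) - T \<omega> x) / \<epsilon>) \<longlongrightarrow> deriv_in D (T \<omega>) x) (at 0)"
      by (simp add: DERIV_def)
    moreover have "filterlim h (at 0) sequentially"
      using lim0 h(1) by (auto simp: filterlim_at intro!: always_eventually less_imp_neq[THEN not_sym])
    ultimately show "(\<lambda>n. (T \<omega> (x + h n) - T \<omega> x) / h n) \<longlonglongrightarrow> deriv_in D (T \<omega>) x"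
      by (rule filterlim_compose)
  qed
qed

text \<open>Continuity of the derivative reduces the supremum to a countable set. The endpoints are
  left out because \<open>deriv_measurable\<close> treats interior points.\<close>

lemma SUP_deriv_rationals:
  assumes \<omega>: "\<omega> \<in> space M" and D: "D \<in> \<G>" "D = {a..b}" "a < b"
  shows "(SUP x\<in>D. ereal \<bar>deriv_in D (T \<omega>) x\<bar>)
    = (SUP x\<in>{a<..<b} \<inter> \<rat>. ereal \<bar>deriv_in D (T \<omega>) x\<bar>)"
proof (rule antisym)
  let ?S = "SUP x\<in>{a<..<b} \<inter> \<rat>. ereal \<bar>deriv_in D (T \<omega>) x\<bar>"
  have upper: "ereal \<bar>deriv_in D (T \<omega>) x\<bar> \<le> ?S" if "x \<in> {a<..<b} \<inter> \<rat>" for x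
    using that by (rule SUP_upper)
  \<comment> \<open>A witness for nonemptiness: it makes the supremum nonnegative, hence a real
    number together with the bound \<open>A\<close>.\<close>
  obtain r where r: "r \<in> {a<..<b} \<inter> \<rat>" using Rats_dense_in_real[OF D(3)] by auto
  have "?S \<le> ereal A"
    using T_deriv_le[OF \<omega> D(1)] D(2) by (intro SUP_least) auto
  moreover have "0 \<le> ?S" using upper[OF r] by (rule order_trans[rotated]) simp
  ultimately obtain s where s: "?S = ereal s" by (cases ?S) auto
  have cl: "closure ({a<..<b} \<inter> \<rat>) = D"
    using closure_open_Int_superset[of "{a<..<b}" \<rat>] D(2,3) by (simp add: Rats_closure_real)
  show "(SUP x\<in>D. ereal \<bar>deriv_in D (T \<omega>) x\<bar>) \<le> ?S"
  proof (rule SUP_least)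
    fix x assume x: "x \<in> D"
    have "\<bar>deriv_in D (T \<omega>) x\<bar> \<le> s"
    proof (rule continuous_le_on_closure[where f = "\<lambda>x. \<bar>deriv_in D (T \<omega>) x\<bar>"])
      show "continuous_on (closure ({a<..<b} \<inter> \<rat>)) (\<lambda>x. \<bar>deriv_in D (T \<omega>) x\<bar>)"
        unfolding cl by (intro continuous_intros deriv_continuous[OF \<omega> D(1)])
      show "x \<in> closure ({a<..<b} \<inter> \<rat>)" unfolding cl by (rule x)
      show "\<bar>deriv_in D (T \<omega>) y\<bar> \<le> s" if "y \<in> {a<..<b} \<inter> \<rat>" for y
        using upper[OF that] s by simp
    qed
    then show "ereal \<bar>deriv_in D (T \<omega>) x\<bar> \<le> ?S" using s by simp
  qed
  show "?S \<le> (SUP x\<in>D. ereal \<bar>deriv_in D (T \<omega>) x\<bar>)"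
    using D(2) by (intro SUP_subset_mono) auto
qed

lemma deriv_sup_measurable:
  "(\<lambda>\<omega>. SUP D\<in>\<G>. SUP x\<in>D. ereal \<bar>deriv_in D (T \<omega>) x\<bar>) \<in> borel_measurable M"
proof (rule borel_measurable_SUP)
  show "countable \<G>" using finite_G by (rule countable_finite)
  fix D assume D: "D \<in> \<G>"
  obtain a b where ab: "0 \<le> a" "a < b" "b \<le> 1" "D = {a..b}" using G_interval[OF D] .
  have "(\<lambda>\<omega>. SUP x\<in>{a<..<b} \<inter> \<rat>. ereal \<bar>deriv_in D (T \<omega>) x\<bar>) \<in> borel_measurable M"
  proof (rule borel_measurable_SUP)
    show "countable ({a<..<b} \<inter> \<rat>)" using countable_rat by auto
    fix x assume "x \<in> {a<..<b} \<inter> \<rat>"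
    then have "(\<lambda>\<omega>. deriv_in D (T \<omega>) x) \<in> borel_measurable M"
      using deriv_measurable[OF D ab(4)] by auto
    then show "(\<lambda>\<omega>. ereal \<bar>deriv_in D (T \<omega>) x\<bar>) \<in> borel_measurable M" by simp
  qed
  then show "(\<lambda>\<omega>. SUP x\<in>D. ereal \<bar>deriv_in D (T \<omega>) x\<bar>) \<in> borel_measurable M"
    by (rule measurable_cong[THEN iffD1, rotated]) (use SUP_deriv_rationals[OF _ D ab(4,2)] in simp)
qed

text \<open>The essential supremum lies between \<open>\<kappa>\<close>, by the slope at 0, and
  \<open>A\<close>, so it is finite and its conversion to a real number loses nothing.\<close>

lemma
  shows deriv_sup_norm_gt_1: "1 < deriv_sup_norm M \<G> T"
    and deriv_sup_norm_AE: "AE \<omega> in M. \<forall>D\<in>\<G>. \<forall>x\<in>D. \<bar>deriv_in D (T \<omega>) x\<bar> \<le> deriv_sup_norm M \<G> T"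
proof -
  define F where "F = (\<lambda>\<omega>. SUP D\<in>\<G>. SUP x\<in>D. ereal \<bar>deriv_in D (T \<omega>) x\<bar>)"
  have F: "F \<in> borel_measurable M" unfolding F_def by (rule deriv_sup_measurable)
  have le_F: "ereal \<bar>deriv_in D (T \<omega>) x\<bar> \<le> F \<omega>" if "D \<in> \<G>" "x \<in> D" for D x \<omega>
    unfolding F_def using that by (intro SUP_upper2[of D] SUP_upper)
  have "esssup M F \<le> ereal A"
  proof (rule esssup_I[OF F])
    show "AE \<omega> in M. F \<omega> \<le> ereal A"
      unfolding F_def using T_deriv_le by (intro AE_I2 SUP_least) auto
  qed
  moreover have "AE \<omega> in M. ereal \<kappa> \<le> esssup M F"
    using esssup_AE[of F M] AE_space
  proof eventually_elim
    case (elim \<omega>)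
    have "ereal \<kappa> \<le> ereal \<bar>deriv_in D0 (T \<omega>) 0\<bar>" using T_deriv_0[OF elim(2)] by simp
    also have "\<dots> \<le> F \<omega>" by (rule le_F[OF D0])
    also have "\<dots> \<le> esssup M F" by (rule elim(1))
    finally show ?case .
  qed
  then have "ereal \<kappa> \<le> esssup M F" by simp
  ultimately obtain B where B: "esssup M F = ereal B" "\<kappa> \<le> B" by (cases "esssup M F") auto
  have norm: "deriv_sup_norm M \<G> T = B" unfolding deriv_sup_norm_def F_def[symmetric] B by simp
  show "1 < deriv_sup_norm M \<G> T" using norm B(2) kappa_gt_1 by simp
  show "AE \<omega> in M. \<forall>D\<in>\<G>. \<forall>x\<in>D. \<bar>deriv_in D (T \<omega>) x\<bar> \<le> deriv_sup_norm M \<G> T"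
    using esssup_AE[of F M]
  proof eventually_elim
    case (elim \<omega>)
    have "\<bar>deriv_in D (T \<omega>) x\<bar> \<le> B" if "D \<in> \<G>" "x \<in> D" for D x
      using order_trans[OF le_F[OF that, of \<omega>] elim] by (simp add: B)
    then show ?case by (simp add: norm)
  qed
qed

section \<open>Passage to the limit in the truncation level\<close>

lemma
  fixes \<nu> :: "real \<Rightarrow> nat \<Rightarrow> 'w \<Rightarrow> real measure" and \<Lambda> :: "real \<Rightarrow> nat \<Rightarrow> 'w \<Rightarrow> real"
  assumes eig: "\<And>t k. 0 \<le> t \<Longrightarrow> 1 \<le> k \<Longrightarrow> random_eigenmeasure M \<theta> T \<G> D0 t k (\<nu> t k) (\<Lambda> t k)"
  shows expected_pressure_convergent: "0 \<le> u \<Longrightarrow> convergent (\<lambda>k. expected_pressure M \<Lambda> k u)"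
    and expected_pressure_inf_antimono: "0 \<le> s \<Longrightarrow> s \<le> t \<Longrightarrow>
      expected_pressure_inf M \<Lambda> t \<le> expected_pressure_inf M \<Lambda> s"
    and expected_pressure_inf_diff_le: "0 \<le> s \<Longrightarrow> s \<le> t \<Longrightarrow>
      expected_pressure_inf M \<Lambda> s - expected_pressure_inf M \<Lambda> t \<le> ln (deriv_sup_norm M \<G> T) * (t - s)"
proof -
  let ?P = "expected_pressure M \<Lambda>" and ?B = "deriv_sup_norm M \<G> T"
  have anti: "?P k t \<le> ?P k s" if st: "0 \<le> s" "s \<le> t" and k: "1 \<le> k" for s t k
  proof -
    have t: "0 \<le> t" using st by simp
    have "AE \<omega> in M. \<forall>n. psum t k n \<omega> \<le> 1 ^ n * psum s k n \<omega>"
      using psum_antimono[OF _ st(2)] by (intro AE_I2) simp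
    from expected_ln_le[OF t k eig[OF t k] st(1) k eig[OF st(1) k] _ this] show ?thesis
      by (simp add: expected_pressure_def)
  qed
  have lip: "?P k s - ?P k t \<le> ln ?B * (t - s)" if st: "0 \<le> s" "s \<le> t" and k: "1 \<le> k" for s t k
  proof -
    have t: "0 \<le> t" using st by simp
    have B: "1 < ?B" by (rule deriv_sup_norm_gt_1)
    \<comment> \<open>The derivative bound holds almost everywhere; invariance of the measure
      extends it to the whole orbit of almost every point, as \<open>psum_lipschitz\<close>
      asks.\<close>
    have "AE \<omega> in M. \<forall>n. psum s k n \<omega> \<le> (?B powr (t - s)) ^ n * psum t k n \<omega>"
      using AE_theta_pow[OF deriv_sup_norm_AE] AE_space
    proof eventually_elim
      case (elim \<omega>)
      then show ?case using B st by (intro allI psum_lipschitz) auto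
    qed
    from expected_ln_le[OF st(1) k eig[OF st(1) k] t k eig[OF t k] _ this] B show ?thesis
      by (simp add: expected_pressure_def ln_powr mult.commute)
  qed
  have mono: "?P k u \<le> ?P (Suc k) u" if u: "0 \<le> u" and k: "1 \<le> k" for u k
  proof -
    have k': "1 \<le> Suc k" by simp
    have "AE \<omega> in M. \<forall>n. psum u k n \<omega> \<le> 1 ^ n * psum u (Suc k) n \<omega>"
      using psum_Suc_le by (intro AE_I2) simp
    from expected_ln_le[OF u k eig[OF u k] u k' eig[OF u k'] _ this] show ?thesis
      by (simp add: expected_pressure_def)
  qed
  have bound: "?P k u \<le> ln (real (card \<G>))" if u: "0 \<le> u" and k: "1 \<le> k" for u k
    using anti[OF _ u k] expected_ln_le_card[OF k eig[OF _ k]] by (simp add: expected_pressure_def)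
  show conv: "convergent (\<lambda>k. ?P k u)" if u: "0 \<le> u" for u
  proof -
    \<comment> \<open>The shift is due to \<open>eig\<close>, which says nothing about
      \<open>k = 0\<close>.\<close>
    have "incseq (\<lambda>k. ?P (Suc k) u)" using mono[OF u] by (intro incseq_SucI) simp
    moreover have "\<forall>k. ?P (Suc k) u \<le> ln (real (card \<G>))" using bound[OF u] by simp
    ultimately obtain L where "(\<lambda>k. ?P (Suc k) u) \<longlonglongrightarrow> L" by (rule incseq_convergent)
    then have "convergent (\<lambda>k. ?P (Suc k) u)" by (rule convergentI)
    then show ?thesis by (simp only: convergent_Suc_iff[of "\<lambda>k. ?P k u"])
  qed
  have lim: "(\<lambda>k. ?P k u) \<longlonglongrightarrow> expected_pressure_inf M \<Lambda> u" if "0 \<le> u" for u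
    using conv[OF that] by (simp add: expected_pressure_inf_def convergent_LIMSEQ_iff)
  show "expected_pressure_inf M \<Lambda> t \<le> expected_pressure_inf M \<Lambda> s" if st: "0 \<le> s" "s \<le> t" for s t
    using anti[OF st] st by (intro LIMSEQ_le[OF lim lim] exI[of _ 1]) auto
  show "expected_pressure_inf M \<Lambda> s - expected_pressure_inf M \<Lambda> t \<le> ln ?B * (t - s)"
    if st: "0 \<le> s" "s \<le> t" for s t
    using lip[OF st] st by (intro LIMSEQ_le_const2[OF tendsto_diff[OF lim lim]] exI[of _ 1]) auto
qed

end

theorem corollary10p3:
  fixes M :: "'w measure" and \<theta> :: "'w \<Rightarrow> 'w" and T :: "'w \<Rightarrow> real \<Rightarrow> real"
    and GC GE :: "real set set" and D0 D1 :: "real set" and \<kappa> A :: real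
    and \<gamma> :: "real set \<Rightarrow> nat" and c v :: "real set \<Rightarrow> real"
    and \<nu> :: "real \<Rightarrow> nat \<Rightarrow> 'w \<Rightarrow> real measure" and \<Lambda> :: "real \<Rightarrow> nat \<Rightarrow> 'w \<Rightarrow> real"
  assumes "random_critically_finite_map M GC GE D0 D1 \<kappa> A \<gamma> c v \<theta> T"
    and "\<And>t k. 0 \<le> t \<Longrightarrow> 1 \<le> k \<Longrightarrow>
           random_eigenmeasure M \<theta> T (GC \<union> GE) D0 t k (\<nu> t k) (\<Lambda> t k)"
  shows "(\<forall>u\<ge>0. convergent (\<lambda>k. expected_pressure M \<Lambda> k u)) \<and>
    (\<forall>s t. 0 \<le> s \<longrightarrow> s \<le> t \<longrightarrow>
       0 \<le> expected_pressure_inf M \<Lambda> s - expected_pressure_inf M \<Lambda> t \<and>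
       expected_pressure_inf M \<Lambda> s - expected_pressure_inf M \<Lambda> t
         \<le> ln (deriv_sup_norm M (GC \<union> GE) T) * (t - s)) \<and>
    antimono_on {0..} (expected_pressure_inf M \<Lambda>) \<and>
    (ln (deriv_sup_norm M (GC \<union> GE) T))-lipschitz_on {0..} (expected_pressure_inf M \<Lambda>)"
proof -
  interpret random_critically_finite_map M GC GE D0 D1 \<kappa> A \<gamma> c v \<theta> T by (rule assms(1))
  let ?P = "expected_pressure_inf M \<Lambda>" and ?L = "ln (deriv_sup_norm M (GC \<union> GE) T)"
  note anti = expected_pressure_inf_antimono[OF assms(2)]
  note lip = expected_pressure_inf_diff_le[OF assms(2)]
  have "?L-lipschitz_on {0..} ?P"
  proof (rule lipschitz_onI)
    \<comment> \<open>A Lipschitz constant must be nonnegative by definition; here this comes from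
      the slope at 0 being at least \<open>\<kappa>\<close>, which exceeds 1.\<close>
    show "0 \<le> ?L" using deriv_sup_norm_gt_1 by simp
    fix x y :: real assume "x \<in> {0..}" "y \<in> {0..}"
    then show "dist (?P x) (?P y) \<le> ?L * dist x y"
      using anti[of x y] lip[of x y] anti[of y x] lip[of y x]
      by (cases "x \<le> y") (auto simp: dist_real_def abs_if)
  qed
  moreover have "antimono_on {0..} ?P" using anti by (auto intro!: monotone_onI)
  ultimately show ?thesis
    using expected_pressure_convergent[OF assms(2)] anti lip by simp
qed

end
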